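(* Let $n\ge 2$ and let $Q_n$ be the fractal Möbius octagonal network of length $n$. Then the number $\tau(Q_n)$ of spanning trees of $Q_n$ is $$\tau(Q_n)=\frac{3n}{2}\left[(4+\sqrt{15})^{n}+(4-\sqrt{15})^{n}+2\right].$$
   Context: The graph $Q_n$ (simple, undirected) has $6n$ vertices $1,2,\ldots,3n$ and $\overline{1},\overline{2},\ldots,\overline{3n}$, and $7n$ edges: $\{i,i+1\}$ and $\{\overline{i},\overline{i+1}\}$ for $1\le i\le 3n-1$; $\{3n,\overline{1}\}$ and $\{\overline{3n},1\}$; and the rungs $\{i,\overline{i}\}$ for $1\le i\le 3n$ with $i\equiv 1 \pmod 3$. (It is obtained from the linear chain $L_n$ of $n$ octagons by identifying the two opposite lateral edges in the reversed way.) *)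

theory Defs
  imports Complex_Main
begin

section \<open>Simple undirected graphs and their spanning trees\<close>

record 'a ugraph =
  verts :: "'a set"
  edges :: "'a set set"

definition simple_graph :: "'a ugraph \<Rightarrow> bool" where
  "simple_graph G \<longleftrightarrow> finite (verts G) \<and> (\<forall>e\<in>edges G. e \<subseteq> verts G \<and> card e = 2)"

definition adj :: "'a ugraph \<Rightarrow> ('a \<times> 'a) set" where
  "adj G = {(u, v). {u, v} \<in> edges G}"

definition connected_graph :: "'a ugraph \<Rightarrow> bool" where
  "connected_graph G \<longleftrightarrow>
     verts G \<noteq> {} \<and> (\<forall>u\<in>verts G. \<forall>v\<in>verts G. (u, v) \<in> (adj G)\<^sup>*)"

text \<open>
  A cycle is given by the list of its vertices, without repeating the initial vertex at the end.
\<close>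

definition cycle :: "'a ugraph \<Rightarrow> 'a list \<Rightarrow> bool" where
  "cycle G c \<longleftrightarrow> 3 \<le> length c \<and> distinct c \<and>
     (\<forall>i<length c. {c ! i, c ! (Suc i mod length c)} \<in> edges G)"

definition tree :: "'a ugraph \<Rightarrow> bool" where
  "tree G \<longleftrightarrow> simple_graph G \<and> connected_graph G \<and> (\<nexists>c. cycle G c)"

definition spanning_tree :: "'a ugraph \<Rightarrow> 'a ugraph \<Rightarrow> bool" where
  "spanning_tree T G \<longleftrightarrow> verts T = verts G \<and> edges T \<subseteq> edges G \<and> tree T"

definition num_spanning_trees :: "'a ugraph \<Rightarrow> nat" where
  "num_spanning_trees G = card {T. spanning_tree T G}"


section \<open>The fractal Moebius octagonal network\<close>

text \<open>
  \<open>Plain i\<close> and \<open>Bar i\<close> stand for the vertices $i$ and $\overline{i}$.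
\<close>

datatype vertex = Plain nat | Bar nat

definition mobius_octagonal :: "nat \<Rightarrow> vertex ugraph" where
  "mobius_octagonal n = \<lparr>
     verts = Plain ` {1..3 * n} \<union> Bar ` {1..3 * n},
     edges = {{Plain i, Plain (i + 1)} | i. 1 \<le> i \<and> i \<le> 3 * n - 1}
           \<union> {{Bar i, Bar (i + 1)} | i. 1 \<le> i \<and> i \<le> 3 * n - 1}
           \<union> {{Plain (3 * n), Bar 1}, {Bar (3 * n), Plain 1}}
           \<union> {{Plain i, Bar i} | i. 1 \<le> i \<and> i \<le> 3 * n \<and> i mod 3 = 1}\<rparr>"

lemma simple_graph_mobius_octagonal:
  assumes "n \<ge> 1"
  shows "simple_graph (mobius_octagonal n)"
  using assms by (auto simp: simple_graph_def mobius_octagonal_def card_insert_if)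

lemma card_verts_mobius_octagonal: "card (verts (mobius_octagonal n)) = 6 * n"
proof -
  have "card (Plain ` {1..3 * n} \<union> Bar ` {1..3 * n}) = card (Plain ` {1..3 * n}) + card (Bar ` {1..3 * n})"
    by (rule card_Un_disjoint) auto
  then show ?thesis
    by (simp add: mobius_octagonal_def card_image inj_on_def)
qed

lemma card_edges_mobius_octagonal:
  assumes "n \<ge> 1"
  shows "card (edges (mobius_octagonal n)) = 7 * n"
proof -
  let ?A = "(\<lambda>i. {Plain i, Plain (i + 1)}) ` {1..3 * n - 1}"
  let ?B = "(\<lambda>i. {Bar i, Bar (i + 1)}) ` {1..3 * n - 1}"
  let ?C = "{{Plain (3 * n), Bar 1}, {Bar (3 * n), Plain 1}}"
  let ?D = "(\<lambda>k. {Plain (3 * k + 1), Bar (3 * k + 1)}) ` {..<n}"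
  have D: "{{Plain i, Bar i} | i. 1 \<le> i \<and> i \<le> 3 * n \<and> i mod 3 = 1} = ?D"
  proof (intro equalityI subsetI)
    fix e assume "e \<in> {{Plain i, Bar i} | i. 1 \<le> i \<and> i \<le> 3 * n \<and> i mod 3 = 1}"
    then obtain i where i: "e = {Plain i, Bar i}" "i \<le> 3 * n" "i mod 3 = 1" by auto
    have "i = 3 * (i div 3) + 1" using i(3) mult_div_mod_eq[of 3 i] by linarith
    moreover from this i(2) have "i div 3 < n" by linarith
    ultimately show "e \<in> ?D" using i(1) by (intro image_eqI[where x = "i div 3"]) simp_all
  next
    fix e assume "e \<in> ?D"
    then obtain k where "e = {Plain (3 * k + 1), Bar (3 * k + 1)}" "k < n" by auto
    moreover from this(2) have "1 \<le> 3 * k + 1" "3 * k + 1 \<le> 3 * n" "(3 * k + 1) mod 3 = 1"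
      by simp_all
    ultimately show "e \<in> {{Plain i, Bar i} | i. 1 \<le> i \<and> i \<le> 3 * n \<and> i mod 3 = 1}" by blast
  qed
  have E: "edges (mobius_octagonal n) = ?A \<union> ?B \<union> ?C \<union> ?D"
    unfolding mobius_octagonal_def D by auto
  have "inj_on (\<lambda>i. {Plain i, Plain (i + 1)}) {1..3 * n - 1}"
    by (auto simp: inj_on_def doubleton_eq_iff)
  then have A: "card ?A = 3 * n - 1" by (simp add: card_image)
  have "inj_on (\<lambda>i. {Bar i, Bar (i + 1)}) {1..3 * n - 1}"
    by (auto simp: inj_on_def doubleton_eq_iff)
  then have B: "card ?B = 3 * n - 1" by (simp add: card_image)
  have C: "card ?C = 2" using assms by (simp add: doubleton_eq_iff)
  have "inj_on (\<lambda>k. {Plain (3 * k + 1), Bar (3 * k + 1)}) {..<n}"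
    by (auto simp: inj_on_def doubleton_eq_iff)
  then have D': "card ?D = n" by (simp add: card_image)
  have AB: "?A \<inter> ?B = {}"
    by (auto simp: doubleton_eq_iff)
  have ABC: "(?A \<union> ?B) \<inter> ?C = {}"
    by (auto simp: doubleton_eq_iff)
  have ABD: "(?A \<union> ?B) \<inter> ?D = {}"
    by (auto simp: doubleton_eq_iff)
  have "?C \<inter> ?D = {}"
    using assms by (simp add: doubleton_eq_iff image_iff)
  then have ABCD: "(?A \<union> ?B \<union> ?C) \<inter> ?D = {}"
    using ABD by (simp only: Int_Un_distrib2 Un_empty_left)
  have "card (?A \<union> ?B \<union> ?C \<union> ?D) = card (?A \<union> ?B \<union> ?C) + card ?D"
    by (rule card_Un_disjoint[OF _ _ ABCD]) simp_all
  also have "card (?A \<union> ?B \<union> ?C) = card (?A \<union> ?B) + card ?C"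
    by (rule card_Un_disjoint[OF _ _ ABC]) simp_all
  also have "card (?A \<union> ?B) = card ?A + card ?B"
    by (rule card_Un_disjoint[OF _ _ AB]) simp_all
  finally have "card (edges (mobius_octagonal n)) = (3 * n - 1) + (3 * n - 1) + 2 + n"
    unfolding E A B C D' .
  then show ?thesis using assms by linarith
qed

end

theory Submission
  imports Defs "HOL-Library.FuncSet"
begin

text \<open>
  The graph is a cycle of length \<open>6n\<close> with chords joining antipodal positions. Fix the nonempty set
  \<open>R\<close> of chords used by a spanning tree. Their ends cut the cycle into pairs of opposite arcs
  (gaps) of lengths \<open>3d\<^sub>1, \<dots>, 3d\<^sub>r\<close> with \<open>d\<^sub>1 + \<dots> + d\<^sub>r = n\<close>. Contracting the
  chords leaves a cycle of \<open>r\<close> vertices whose edges are doubled paths, so a spanning tree arises by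
  cutting both arcs of exactly one gap and one arc of every other gap. Compare with transversals,
  which cut one arc per gap: each extends to \<open>3n\<close> trees, and each tree contains two of them, so
  there are \<open>(3n/2) * (6d\<^sub>1) * \<dots> * (6d\<^sub>r)\<close> trees. Summing the products over all nonempty \<open>R\<close> gives
  \<open>(4 + sqrt 15)^n + (4 - sqrt 15)^n - 2\<close>, and \<open>R = {}\<close> contributes \<open>6n = (3n/2) * 4\<close>.
\<close>

section \<open>Trees by counting edges\<close>

text \<open>The crossed gluing makes the rails one cycle of length 2N, N = 3n, on which opposite
  arcs change places after N steps. Lifting positions to all integers treats the twist like any
  other place: \<open>prv\<close> commutes with shifts by N, its value modulo N names a gap and
  modulo 2N one of the two arcs. Paths would be awkward to carry through this covering, whereas
  Boolean labellings constant along edges pull back by composition, so connectivity is tested by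
  labellings; acyclicity is replaced by an edge count.

  A direct count would take gap i as the doubly cut one, with (3 d_i)^2 choices there and 6 d_j
  elsewhere. The ratio to the full product is 3 d_i / 2, and these ratios add up to 3n/2. The double
  count with transversals gives this factor without a sum over i.

  For the sum over chord sets, the wrapping gap contributes the factor 6 (n - Max R + Min R). The
  product over the other gaps gains one factor when a new maximum is appended, so a recursion over
  the ground set has to remember only the maximum and the minimum.\<close>

definition component_of :: "'a set set \<Rightarrow> 'a \<Rightarrow> 'a set" where
  "component_of F u = {v. (u, v) \<in> {(x, y). {x, y} \<in> F}\<^sup>*}"

lemma component_of_refl: "u \<in> component_of F u"
  by (simp add: component_of_def)

lemma component_of_eq_iff: "component_of F u = component_of F v \<longleftrightarrow> v \<in> component_of F u"
proof
  assume "component_of F u = component_of F v"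
  then show "v \<in> component_of F u" by (simp add: component_of_refl)
next
  assume v: "v \<in> component_of F u"
  have "sym {(x, y). {x, y} \<in> F}" by (auto simp: sym_def insert_commute)
  then have "sym ({(x, y). {x, y} \<in> F}\<^sup>*)" by (rule sym_rtrancl)
  with v have "(u, v) \<in> {(x, y). {x, y} \<in> F}\<^sup>*" "(v, u) \<in> {(x, y). {x, y} \<in> F}\<^sup>*"
    by (auto simp: component_of_def dest: symD)
  then show "component_of F u = component_of F v"
    unfolding component_of_def by (auto intro: rtrancl_trans)
qed

lemma component_of_mono: "F \<subseteq> G \<Longrightarrow> component_of F u \<subseteq> component_of G u"
  unfolding component_of_def using rtrancl_mono[of "{(x, y). {x, y} \<in> F}" "{(x, y). {x, y} \<in> G}"] by auto

lemma component_of_closed: "v \<in> component_of F u \<Longrightarrow> {v, w} \<in> F \<Longrightarrow> w \<in> component_of F u"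
  unfolding component_of_def by (auto intro: rtrancl_into_rtrancl)

lemma component_of_least:
  assumes "u \<in> A" "\<And>v w. v \<in> A \<Longrightarrow> {v, w} \<in> F \<Longrightarrow> w \<in> A"
  shows "component_of F u \<subseteq> A"
proof
  fix w assume "w \<in> component_of F u"
  then have "(u, w) \<in> {(x, y). {x, y} \<in> F}\<^sup>*" by (simp add: component_of_def)
  then show "w \<in> A" by induction (use assms in auto)
qed

text \<open>The union of the classes of \<open>u\<close> and \<open>v\<close> is closed under the
  old edges and the new one, and a class that contains neither end stays closed.\<close>

lemma component_of_insert:
  "component_of (insert {u, v} F) x =
    (if component_of F x \<in> {component_of F u, component_of F v}
     then component_of F u \<union> component_of F v else component_of F x)"
proof (cases "component_of F x \<in> {component_of F u, component_of F v}")
  case True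
  let ?G = "insert {u, v} F"
  have uv: "component_of ?G u = component_of ?G v"
    unfolding component_of_eq_iff using component_of_closed[OF component_of_refl, of u v ?G] by simp
  have "x \<in> component_of F u \<or> x \<in> component_of F v"
    using True component_of_eq_iff[of F _ x] by auto
  then have "x \<in> component_of ?G u"
    using component_of_mono[of F ?G] uv by blast
  then have x: "component_of ?G x = component_of ?G u" using component_of_eq_iff[of ?G u x] by simp
  have "component_of ?G u \<subseteq> component_of F u \<union> component_of F v"
    by (rule component_of_least)
       (auto simp: component_of_refl doubleton_eq_iff intro: component_of_closed)
  moreover have "component_of F u \<union> component_of F v \<subseteq> component_of ?G u"
    using component_of_mono[of F ?G] uv by blast
  ultimately show ?thesis using True x by auto
next
  case False
  then have "u \<notin> component_of F x" "v \<notin> component_of F x"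
    using component_of_eq_iff[of F x] by auto
  then have "component_of (insert {u, v} F) x \<subseteq> component_of F x"
    by (intro component_of_least) (auto simp: component_of_refl doubleton_eq_iff intro: component_of_closed)
  moreover have "component_of F x \<subseteq> component_of (insert {u, v} F) x"
    by (rule component_of_mono) auto
  ultimately show ?thesis using False by simp
qed

definition num_components :: "'a set \<Rightarrow> 'a set set \<Rightarrow> nat" where
  "num_components V F = card (component_of F ` V)"

lemma num_components_insert_same:
  assumes "v \<in> component_of F u"
  shows "num_components V (insert {u, v} F) = num_components V F"
proof -
  have "component_of F u = component_of F v" using assms by (simp add: component_of_eq_iff)
  then have "component_of (insert {u, v} F) x = component_of F x" for x
    by (subst component_of_insert) auto
  then show ?thesis by (simp add: num_components_def)
qed

lemma num_components_insert_new:
  assumes "finite V" "u \<in> V" "v \<in> V" "v \<notin> component_of F u"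
  shows "Suc (num_components V (insert {u, v} F)) = num_components V F"
proof -
  let ?c = "component_of F" and ?W = "component_of F u \<union> component_of F v"
  have ne: "?c u \<noteq> ?c v" using assms(4) by (simp add: component_of_eq_iff)
  \<comment> \<open>The merged class is not one of the old classes, so two classes disappear and
    exactly one new one is added.\<close>
  have W: "?W \<notin> ?c ` V"
  proof
    assume "?W \<in> ?c ` V"
    then obtain x where "?c x = ?W" by auto
    then have "u \<in> ?c x" "v \<in> ?c x" by (auto simp: component_of_refl)
    then have "?c x = ?c u" "?c x = ?c v" by (simp_all add: component_of_eq_iff)
    with ne show False by simp
  qed
  have img: "component_of (insert {u, v} F) ` V = insert ?W (?c ` V - {?c u, ?c v})"
  proof -
    have "component_of (insert {u, v} F) ` V = (\<lambda>C. if C \<in> {?c u, ?c v} then ?W else C) ` (?c ` V)"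
      unfolding image_image by (intro image_cong refl) (rule component_of_insert)
    also have "\<dots> = insert ?W (?c ` V - {?c u, ?c v})" using assms(2) by auto
    finally show ?thesis .
  qed
  have "card (insert ?W (?c ` V - {?c u, ?c v})) = Suc (card (?c ` V - {?c u, ?c v}))"
    using assms(1) W by simp
  also have "card (?c ` V - {?c u, ?c v}) = card (?c ` V) - 2"
    using ne assms by (subst card_Diff_subset) auto
  finally have "num_components V (insert {u, v} F) = Suc (card (?c ` V) - 2)"
    unfolding num_components_def img .
  moreover have "card (?c ` V) \<ge> 2"
    using ne assms card_mono[of "?c ` V" "{?c u, ?c v}"] by auto
  ultimately show ?thesis by (simp add: num_components_def)
qed

lemma num_components_empty: "num_components V {} = card V"
proof -
  have "component_of {} u = {u}" for u :: 'a
    by (simp add: component_of_def)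
  then show ?thesis by (simp add: num_components_def card_image)
qed

lemma simple_edgeE:
  assumes "simple_graph \<lparr>verts = V, edges = F\<rparr>" "e \<in> F"
  obtains u v where "e = {u, v}" "u \<noteq> v" "u \<in> V" "v \<in> V"
  using assms unfolding simple_graph_def by (auto simp: card_2_iff)

lemma simple_graph_subset:
  "simple_graph \<lparr>verts = V, edges = F\<rparr> \<Longrightarrow> G \<subseteq> F \<Longrightarrow> simple_graph \<lparr>verts = V, edges = G\<rparr>"
  by (auto simp: simple_graph_def)

lemma simple_graph_finite_edges:
  "simple_graph \<lparr>verts = V, edges = F\<rparr> \<Longrightarrow> finite F"
  by (rule finite_subset[of F "Pow V"]) (auto simp: simple_graph_def)

text \<open>Starting from \<open>card V\<close> singletons, each inserted edge lowers the number of
  components by at most one.\<close>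

lemma card_verts_le_edges_plus_components:
  assumes "simple_graph \<lparr>verts = V, edges = F\<rparr>"
  shows "card V \<le> card F + num_components V F"
proof -
  have "finite F" using assms by (rule simple_graph_finite_edges)
  then show ?thesis using assms
  proof induction
    case empty
    then show ?case by (simp add: num_components_empty)
  next
    case (insert e F)
    have le: "card V \<le> card F + num_components V F"
      using insert.IH simple_graph_subset[OF insert.prems] by blast
    obtain u v where e: "e = {u, v}" "u \<in> V" "v \<in> V"
      by (rule simple_edgeE[OF insert.prems]) auto
    have "finite V" using insert.prems by (simp add: simple_graph_def)
    with e le num_components_insert_same[of v F u V] num_components_insert_new[of V u v F] insert.hyps
    show ?case by (cases "v \<in> component_of F u") auto
  qed
qed

lemma distinct_path_exists:
  assumes "v \<in> component_of F u"
  shows "\<exists>xs. xs \<noteq> [] \<and> distinct xs \<and> hd xs = u \<and> last xs = v \<and>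
    (\<forall>i. Suc i < length xs \<longrightarrow> {xs ! i, xs ! Suc i} \<in> F)"
proof -
  have "(u, v) \<in> {(x, y). {x, y} \<in> F}\<^sup>*" using assms by (simp add: component_of_def)
  then show ?thesis
  proof induction
    case base
    show ?case by (rule exI[of _ "[u]"]) simp
  next
    case (step y z)
    then obtain xs where xs: "xs \<noteq> []" "distinct xs" "hd xs = u" "last xs = y"
      "\<forall>i. Suc i < length xs \<longrightarrow> {xs ! i, xs ! Suc i} \<in> F" by auto
    show ?case
    proof (cases "z \<in> set xs")
      case True
      then obtain j where j: "j < length xs" "xs ! j = z" by (auto simp: in_set_conv_nth)
      \<comment> \<open>A walk that returns to a vertex already visited is cut back to that visit,
        which keeps the list distinct.\<close>
      let ?ys = "take (Suc j) xs"
      have "last ?ys = z" using j by (simp add: take_Suc_conv_app_nth)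
      moreover have "hd ?ys = u" using xs by simp
      moreover have "\<forall>i. Suc i < length ?ys \<longrightarrow> {?ys ! i, ?ys ! Suc i} \<in> F" using xs(5) by auto
      ultimately show ?thesis using xs(1,2) by (intro exI[of _ ?ys]) auto
    next
      case False
      have "{(xs @ [z]) ! i, (xs @ [z]) ! Suc i} \<in> F" if "Suc i < length (xs @ [z])" for i
      proof (cases "Suc i = length xs")
        case True
        then have "xs ! i = y" using xs(1,4) by (metis diff_Suc_1 last_conv_nth)
        then show ?thesis using True step(2) by (simp add: nth_append)
      next
        case False
        then show ?thesis using that xs(5) by (simp add: nth_append)
      qed
      then show ?thesis using False xs by (intro exI[of _ "xs @ [z]"]) auto
    qed
  qed
qed

lemma cycle_from_component:
  assumes "v \<in> component_of F u" "u \<noteq> v" "{u, v} \<notin> F"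
  shows "\<exists>c. cycle \<lparr>verts = V, edges = insert {u, v} F\<rparr> c"
proof -
  obtain xs where xs: "xs \<noteq> []" "distinct xs" "hd xs = u" "last xs = v"
    "\<forall>i. Suc i < length xs \<longrightarrow> {xs ! i, xs ! Suc i} \<in> F"
    using distinct_path_exists[OF assms(1)] by blast
  have nth: "xs ! 0 = u" "xs ! (length xs - 1) = v"
    using xs by (simp_all add: hd_conv_nth last_conv_nth)
  \<comment> \<open>A list of two vertices would make \<open>{u, v}\<close> an edge of
    \<open>F\<close>; excluding it secures the minimal length 3 of a cycle.\<close>
  have "length xs \<noteq> 0" "length xs \<noteq> 1" "length xs \<noteq> 2"
    using xs(1,5) nth assms(2,3) by (auto dest: spec[of _ 0])
  then have len: "3 \<le> length xs" by linarith
  have "{xs ! i, xs ! (Suc i mod length xs)} \<in> insert {u, v} F" if "i < length xs" for i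
  proof (cases "Suc i = length xs")
    case True
    then have "i = length xs - 1" by simp
    then show ?thesis using True nth by auto
  next
    case False
    then show ?thesis using that xs(5) by auto
  qed
  then show ?thesis using len xs(2) by (intro exI[of _ xs]) (simp add: cycle_def)
qed

lemma cycle_imp_non_bridge:
  assumes "cycle \<lparr>verts = V, edges = F\<rparr> c"
  shows "\<exists>u v. {u, v} \<in> F \<and> v \<in> component_of (F - {{u, v}}) u"
proof -
  let ?l = "length c"
  let ?u = "c ! 0" and ?v = "c ! (?l - 1)"
  have c: "3 \<le> ?l" "distinct c" "\<And>i. i < ?l \<Longrightarrow> {c ! i, c ! (Suc i mod ?l)} \<in> F"
    using assms by (auto simp: cycle_def)
  have "Suc (?l - 1) = ?l" using c(1) by simp
  then have "Suc (?l - 1) mod ?l = 0" by simp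
  then have uv: "{?u, ?v} \<in> F" using c(3)[of "?l - 1"] c(1) by (simp add: insert_commute)
  have "c ! i \<in> component_of (F - {{?u, ?v}}) ?u" if "i < ?l" for i
    using that
  proof (induction i)
    case 0
    show ?case by (rule component_of_refl)
  next
    case (Suc i)
    have "{c ! i, c ! Suc i} \<noteq> {?u, ?v}"
    proof
      assume "{c ! i, c ! Suc i} = {?u, ?v}"
      then have "c ! i = ?u \<and> c ! Suc i = ?v \<or> c ! i = ?v \<and> c ! Suc i = ?u"
        by (simp add: doubleton_eq_iff)
      moreover have "0 < ?l" "?l - 1 < ?l" "i < ?l" using c(1) Suc.prems by linarith+
      ultimately have "i = 0 \<and> Suc i = ?l - 1 \<or> i = ?l - 1 \<and> Suc i = 0"
        using Suc.prems nth_eq_iff_index_eq[OF c(2)] by metis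
      then show False using c(1) by linarith
    qed
    then have "{c ! i, c ! Suc i} \<in> F - {{?u, ?v}}" using c(3)[of i] Suc.prems by auto
    then show ?case using Suc.IH Suc.prems component_of_closed[of "c ! i"] by simp
  qed
  then have "?v \<in> component_of (F - {{?u, ?v}}) ?u" using c(1) by auto
  with uv show ?thesis by blast
qed

text \<open>An edge inserted within a component would close a path to a cycle, so every edge merges
  two components and the inequality above becomes an equality.\<close>

lemma acyclic_card_edges:
  assumes "simple_graph \<lparr>verts = V, edges = F\<rparr>" "\<nexists>c. cycle \<lparr>verts = V, edges = F\<rparr> c"
  shows "card F + num_components V F = card V"
proof -
  have "finite F" using assms(1) by (rule simple_graph_finite_edges)
  then show ?thesis using assms
  proof induction
    case empty
    then show ?case by (simp add: num_components_empty)
  next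
    case (insert e F)
    have "\<nexists>c. cycle \<lparr>verts = V, edges = F\<rparr> c"
      using insert.prems(2) by (auto simp: cycle_def)
    then have eq: "card F + num_components V F = card V"
      using insert.IH simple_graph_subset[OF insert.prems(1)] by blast
    obtain u v where e: "e = {u, v}" "u \<noteq> v" "u \<in> V" "v \<in> V"
      by (rule simple_edgeE[OF insert.prems(1)]) auto
    have "v \<notin> component_of F u"
      using cycle_from_component[of v F u V] insert e by auto
    moreover have "finite V" using insert.prems by (simp add: simple_graph_def)
    ultimately show ?case using eq e num_components_insert_new[of V u v F] insert.hyps by auto
  qed
qed

lemma connected_graph_iff_component:
  "connected_graph \<lparr>verts = V, edges = F\<rparr> \<longleftrightarrow> V \<noteq> {} \<and> (\<forall>u\<in>V. V \<subseteq> component_of F u)"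
  by (auto simp: connected_graph_def adj_def component_of_def)

lemma connected_graph_num_components:
  assumes "connected_graph \<lparr>verts = V, edges = F\<rparr>"
  shows "num_components V F = 1"
proof -
  obtain u where u: "u \<in> V" and sub: "\<forall>u\<in>V. V \<subseteq> component_of F u"
    using assms by (auto simp: connected_graph_iff_component)
  have "component_of F w = component_of F u" if "w \<in> V" for w
    using that u sub component_of_eq_iff[of F w u] by auto
  then have "component_of F ` V = {component_of F u}" using u by blast
  then show ?thesis by (simp add: num_components_def)
qed

lemma connected_graph_card_le:
  assumes "simple_graph \<lparr>verts = V, edges = F\<rparr>" "connected_graph \<lparr>verts = V, edges = F\<rparr>"
  shows "card V \<le> card F + 1"
  using card_verts_le_edges_plus_components[OF assms(1)] connected_graph_num_components[OF assms(2)]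
  by simp

theorem tree_iff_card_edges:
  assumes "simple_graph \<lparr>verts = V, edges = F\<rparr>"
  shows "tree \<lparr>verts = V, edges = F\<rparr> \<longleftrightarrow>
    connected_graph \<lparr>verts = V, edges = F\<rparr> \<and> card V = card F + 1"
proof
  assume "tree \<lparr>verts = V, edges = F\<rparr>"
  then show "connected_graph \<lparr>verts = V, edges = F\<rparr> \<and> card V = card F + 1"
    using acyclic_card_edges[OF assms] connected_graph_num_components[of V F]
    by (auto simp: tree_def)
next
  assume *: "connected_graph \<lparr>verts = V, edges = F\<rparr> \<and> card V = card F + 1"
  \<comment> \<open>Deleting an edge that lies on a cycle keeps a single component but leaves only
    \<open>card V - 2\<close> edges, one too few.\<close>
  have "False" if cyc: "cycle \<lparr>verts = V, edges = F\<rparr> c" for c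
  proof -
    obtain u v where uv: "{u, v} \<in> F" "v \<in> component_of (F - {{u, v}}) u"
      using cycle_imp_non_bridge[OF cyc] by blast
    let ?F = "F - {{u, v}}"
    have "insert {u, v} ?F = F" using uv by auto
    then have "num_components V ?F = 1"
      using num_components_insert_same[OF uv(2), of V] * connected_graph_num_components[of V F] by simp
    moreover have "card V \<le> card ?F + num_components V ?F"
      by (rule card_verts_le_edges_plus_components, rule simple_graph_subset[OF assms]) auto
    moreover have "Suc (card ?F) = card F"
      using uv(1) simple_graph_finite_edges[OF assms] by (simp add: card_Suc_Diff1 del: card_Diff_insert)
    ultimately show False using * by simp
  qed
  with * assms show "tree \<lparr>verts = V, edges = F\<rparr>" by (auto simp: tree_def)
qed

text \<open>A two-valued labelling constant on edges is constant on each component, and the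
  indicator of a component is such a labelling.\<close>

lemma connected_graph_iff_labelling:
  assumes "V \<noteq> {}" "simple_graph \<lparr>verts = V, edges = F\<rparr>"
  shows "connected_graph \<lparr>verts = V, edges = F\<rparr> \<longleftrightarrow>
    (\<forall>\<chi> :: 'a \<Rightarrow> bool. (\<forall>u v. {u, v} \<in> F \<longrightarrow> \<chi> u = \<chi> v) \<longrightarrow> (\<forall>u\<in>V. \<forall>v\<in>V. \<chi> u = \<chi> v))"
    (is "_ \<longleftrightarrow> ?R")
proof
  assume c: "connected_graph \<lparr>verts = V, edges = F\<rparr>"
  show ?R
  proof (intro allI impI ballI)
    fix \<chi> :: "'a \<Rightarrow> bool" and u v
    assume \<chi>: "\<forall>u v. {u, v} \<in> F \<longrightarrow> \<chi> u = \<chi> v" and uv: "u \<in> V" "v \<in> V"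
    have "component_of F u \<subseteq> {w. \<chi> w = \<chi> u}"
      by (rule component_of_least) (use \<chi> in auto)
    then show "\<chi> u = \<chi> v" using c uv by (auto simp: connected_graph_iff_component)
  qed
next
  assume R: ?R
  have "v \<in> component_of F u" if uv: "u \<in> V" "v \<in> V" for u v
  proof -
    have "\<forall>x y. {x, y} \<in> F \<longrightarrow> (x \<in> component_of F u) = (y \<in> component_of F u)"
      by (metis component_of_closed insert_commute)
    then have "\<forall>x\<in>V. \<forall>y\<in>V. (x \<in> component_of F u) = (y \<in> component_of F u)"
      by (rule R[THEN spec, THEN mp])
    then show ?thesis using uv component_of_refl[of u F] by blast
  qed
  then show "connected_graph \<lparr>verts = V, edges = F\<rparr>"
    using assms(1) by (auto simp: connected_graph_iff_component)
qed

section \<open>Connectivity of cycles with antipodal chords\<close>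

text \<open>
  Positions on the rail cycle are integers modulo \<open>2 * N\<close>; the chord at \<open>a\<close> joins \<open>a\<close> and \<open>a + N\<close>,
  and \<open>D\<close> holds the positions \<open>x\<close> whose rail \<open>x, x + 1\<close> is deleted.
\<close>

definition coherent_labelling :: "int \<Rightarrow> int set \<Rightarrow> int set \<Rightarrow> (int \<Rightarrow> bool) \<Rightarrow> bool" where
  "coherent_labelling N D A \<chi> \<longleftrightarrow>
     (\<forall>x. \<chi> (x + 2 * N) = \<chi> x) \<and>
     (\<forall>x. x mod (2 * N) \<notin> D \<longrightarrow> \<chi> (x + 1) = \<chi> x) \<and>
     (\<forall>a\<in>A. \<chi> (a + N) = \<chi> a)"

definition ladder_connected :: "int \<Rightarrow> int set \<Rightarrow> int set \<Rightarrow> bool" where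
  "ladder_connected N D A \<longleftrightarrow> (\<forall>\<chi>. coherent_labelling N D A \<chi> \<longrightarrow> (\<forall>x y. \<chi> x = \<chi> y))"

lemma coherent_labelling_period:
  assumes "coherent_labelling N D A \<chi>"
  shows "\<chi> (x + k * (2 * N)) = \<chi> x"
proof (induction k rule: int_induct[where k = 0])
  case (step1 i)
  have "x + (i + 1) * (2 * N) = (x + i * (2 * N)) + 2 * N" by (simp add: algebra_simps)
  with step1 assms show ?case unfolding coherent_labelling_def by metis
next
  case (step2 i)
  have "x + i * (2 * N) = (x + (i - 1) * (2 * N)) + 2 * N" by (simp add: algebra_simps)
  with step2 assms show ?case unfolding coherent_labelling_def by metis
qed simp

lemma coherent_labelling_mod:
  assumes "coherent_labelling N D A \<chi>"
  shows "\<chi> (x mod (2 * N)) = \<chi> x"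
  using coherent_labelling_period[OF assms, of "x mod (2 * N)" "x div (2 * N)"]
  by (simp only: mod_div_mult_eq)

lemma coherent_labelling_segment:
  assumes "coherent_labelling N D A \<chi>" "u \<le> v" "\<And>w. u \<le> w \<Longrightarrow> w < v \<Longrightarrow> w mod (2 * N) \<notin> D"
  shows "\<chi> v = \<chi> u"
proof -
  have "\<forall>v. (\<forall>w. u \<le> w \<longrightarrow> w < v \<longrightarrow> w mod (2 * N) \<notin> D) \<longrightarrow> u + int n = v \<longrightarrow> \<chi> v = \<chi> u" for n
  proof (induction n)
    case (Suc n)
    have "\<chi> (u + int n + 1) = \<chi> (u + int n)" if "(u + int n) mod (2 * N) \<notin> D"
      using assms(1) that by (simp add: coherent_labelling_def)
    with Suc show ?case by (auto simp: algebra_simps)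
  qed simp
  from this[of "nat (v - u)"] show ?thesis using assms(2,3) by auto
qed

lemma ladder_connected_no_chords:
  assumes "0 < N" "d \<in> {0..<2 * N}"
  shows "ladder_connected N {d} {}"
  unfolding ladder_connected_def
proof (intro allI impI)
  fix \<chi> x y assume \<chi>: "coherent_labelling N {d} {} \<chi>"
  have "\<chi> z = \<chi> (d + 1)" for z
  proof -
    \<comment> \<open>The representative of \<open>z\<close> in the turn that starts just behind the
      deleted rail; nothing on the way to it is cut.\<close>
    define w where "w = d + 1 + (z - d - 1) mod (2 * N)"
    have bd: "d + 1 \<le> w" "w < d + 1 + 2 * N" using assms(1) by (simp_all add: w_def)
    have "w' mod (2 * N) \<notin> {d}" if "d + 1 \<le> w'" "w' < w" for w'
    proof
      assume "w' mod (2 * N) \<in> {d}"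
      then have "w' mod (2 * N) = d mod (2 * N)" using assms(2) by simp
      then have "2 * N dvd w' - d" by (simp add: mod_eq_dvd_iff)
      then show False using zdvd_imp_le[of "2 * N" "w' - d"] that bd by simp
    qed
    then have "\<chi> w = \<chi> (d + 1)" using coherent_labelling_segment[OF \<chi> bd(1)] by blast
    moreover have "w mod (2 * N) = z mod (2 * N)" by (simp add: w_def mod_simps)
    ultimately show ?thesis using coherent_labelling_mod[OF \<chi>] by metis
  qed
  then show "\<chi> x = \<chi> y" by metis
qed

section \<open>Arcs and gaps between chord ends\<close>

locale chord_set =
  fixes N :: int and A :: "int set"
  assumes N_pos: "0 < N" and A_sub: "A \<subseteq> {0..<N}" and A_nonempty: "A \<noteq> {}"
begin

definition chord_ends :: "int set" where "chord_ends = {s. s mod N \<in> A}"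

text \<open>This is the last chord end at or before \<open>x\<close>. A window of \<open>N\<close>
  consecutive integers meets every residue class modulo \<open>N\<close>, so the set is finite and
  nonempty and \<open>Max\<close> is meaningful.\<close>

definition prv :: "int \<Rightarrow> int" where "prv x = Max {s \<in> chord_ends. x - N < s \<and> s \<le> x}"

text \<open>
  The chord ends cut the rail cycle into arcs, named by their first position modulo \<open>2 * N\<close>;
  opposite arcs have the same first position modulo \<open>N\<close> and together form a gap.
\<close>

definition arc :: "int \<Rightarrow> int" where "arc x = prv x mod (2 * N)"

definition gap :: "int \<Rightarrow> int" where "gap x = prv x mod N"

lemma finite_A: "finite A"
  using A_sub finite_subset by blast

lemma chord_ends_shift: "s + k * N \<in> chord_ends \<longleftrightarrow> s \<in> chord_ends"
  by (simp add: chord_ends_def)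

lemma A_subset_chord_ends: "a \<in> A \<Longrightarrow> a \<in> chord_ends"
  using A_sub by (auto simp: chord_ends_def)

lemma window_nonempty: "{s \<in> chord_ends. x - N < s \<and> s \<le> x} \<noteq> {}"
proof -
  obtain a where a: "a \<in> A" using A_nonempty by blast
  define s where "s = x - (x - a) mod N"
  have "s = a + ((x - a) div N) * N"
    using minus_mod_eq_div_mult[of "x - a" N] by (simp add: s_def)
  then have "s \<in> chord_ends" using chord_ends_shift A_subset_chord_ends[OF a] by simp
  moreover have "x - N < s" "s \<le> x" using N_pos by (simp_all add: s_def)
  ultimately show ?thesis by blast
qed

lemma prv_window: "prv x \<in> {s \<in> chord_ends. x - N < s \<and> s \<le> x}"
  unfolding prv_def by (rule Max_in[OF _ window_nonempty]) (rule finite_subset[of _ "{x - N..x}"], auto)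

lemma prv_in_chord_ends: "prv x \<in> chord_ends" and prv_le: "prv x \<le> x" and prv_gt: "x - N < prv x"
  using prv_window[of x] by auto

lemma prv_greatest: "s \<in> chord_ends \<Longrightarrow> s \<le> x \<Longrightarrow> s \<le> prv x"
proof (cases "x - N < s")
  case True
  assume "s \<in> chord_ends" "s \<le> x"
  with True show ?thesis
    unfolding prv_def by (intro Max_ge) (auto intro: finite_subset[of _ "{x - N..x}"])
next
  case False
  then show ?thesis using prv_gt[of x] by simp
qed

lemma prv_eqI: "s \<in> chord_ends \<Longrightarrow> s \<le> x \<Longrightarrow> (\<And>t. t \<in> chord_ends \<Longrightarrow> t \<le> x \<Longrightarrow> t \<le> s) \<Longrightarrow> prv x = s"
  using prv_greatest[of s x] prv_in_chord_ends[of x] prv_le[of x] by (auto intro: antisym)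

lemma prv_chord_end: "s \<in> chord_ends \<Longrightarrow> prv s = s"
  by (rule prv_eqI) auto

lemma prv_shift: "prv (x + k * N) = prv x + k * N"
proof (rule prv_eqI)
  show "prv x + k * N \<in> chord_ends" using prv_in_chord_ends chord_ends_shift by blast
  show "prv x + k * N \<le> x + k * N" using prv_le by simp
next
  fix t assume t: "t \<in> chord_ends" "t \<le> x + k * N"
  have "t - k * N \<in> chord_ends" using t(1) chord_ends_shift[of "t - k * N" k] by simp
  then have "t - k * N \<le> prv x" using t(2) by (intro prv_greatest) auto
  then show "t \<le> prv x + k * N" by simp
qed

lemma gap_in_A: "gap x \<in> A"
  using prv_in_chord_ends by (simp add: gap_def chord_ends_def)

lemma gap_arc: "gap x = arc x mod N"
  by (simp add: gap_def arc_def mod_mod_cancel)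

lemma arc_shift: "arc (x + k * (2 * N)) = arc x"
  using prv_shift[of x "2 * k"] by (simp add: arc_def mult.assoc mult.left_commute)

lemma arc_mod: "arc (x mod (2 * N)) = arc x"
  using arc_shift[of "x mod (2 * N)" "x div (2 * N)"] by (simp only: mod_div_mult_eq)

lemma gap_mod: "gap (x mod (2 * N)) = gap x"
  by (simp add: gap_arc arc_mod)

lemma gap_shift: "gap (x + k * N) = gap x"
  using prv_shift[of x k] by (simp add: gap_def)

lemma arc_opposite_neq: "arc (x + N) \<noteq> arc x"
proof
  assume "arc (x + N) = arc x"
  then have "2 * N dvd prv x + N - prv x"
    using prv_shift[of x 1] by (simp only: arc_def mod_eq_dvd_iff mult_1)
  then show False using N_pos zdvd_imp_le[of "2 * N" N] by simp
qed

text \<open>A residue class modulo \<open>N\<close> splits into two classes modulo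
  \<open>2 * N\<close>, distinguished by the parity of the quotient.\<close>

lemma arc_cases:
  assumes "gap x = gap y"
  shows "arc x = arc y \<or> arc x = arc (y + N)"
proof -
  have "N dvd prv x - prv y" using assms by (simp add: gap_def mod_eq_dvd_iff)
  then obtain k where k: "prv x - prv y = N * k" by (auto simp: dvd_def)
  show ?thesis
  proof (cases "even k")
    case True
    then obtain j where "k = 2 * j" by (auto simp: dvd_def)
    then have "2 * N dvd prv x - prv y" using k by simp
    then show ?thesis by (simp add: arc_def mod_eq_dvd_iff)
  next
    case False
    then obtain j where "k = 2 * j + 1" by (auto elim: oddE)
    then have "prv x - (prv y + N) = 2 * N * j" using k by (simp add: algebra_simps)
    then have "2 * N dvd prv x - prv (y + N)" using prv_shift[of y 1] by simp
    then show ?thesis by (simp add: arc_def mod_eq_dvd_iff)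
  qed
qed

text \<open>Full turns make two positions on the same arc share their \<open>prv\<close> as
  integers, the form in which \<open>two_deletions_disconnect\<close> applies.\<close>

lemma arc_subst: "arc x = arc y \<Longrightarrow> \<exists>k. prv (x + k * (2 * N)) = prv y"
proof -
  assume "arc x = arc y"
  then have "2 * N dvd prv x - prv y" by (simp add: arc_def mod_eq_dvd_iff)
  then have "2 * N dvd prv y - prv x" by (subst dvd_diff_commute)
  then obtain k where "prv y - prv x = 2 * N * k" by (auto simp: dvd_def)
  then have "prv (x + (2 * k) * N) = prv y" using prv_shift[of x "2 * k"] by (simp add: algebra_simps)
  then show ?thesis by (intro exI[of _ k]) (simp add: algebra_simps)
qed

text \<open>Since \<open>prv x + N\<close> is a chord end beyond \<open>x\<close>, there is a first
  one, and \<open>prv\<close> stays constant until it is reached.\<close>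

lemma next_exists:
  obtains t where "t \<in> chord_ends" "x < t" "t \<le> prv x + N" "\<And>w. x \<le> w \<Longrightarrow> w < t \<Longrightarrow> prv w = prv x"
proof -
  let ?W = "{s \<in> chord_ends. x < s \<and> s \<le> prv x + N}"
  have fin: "finite ?W" by (rule finite_subset[of _ "{x..prv x + N}"]) auto
  have "prv x + N \<in> ?W" using prv_in_chord_ends chord_ends_shift[of "prv x" 1] prv_gt[of x] by simp
  then have ne: "?W \<noteq> {}" by blast
  have Min: "Min ?W \<in> ?W" by (rule Min_in[OF fin ne])
  have "prv w = prv x" if w: "x \<le> w" "w < Min ?W" for w
  proof (rule prv_eqI[OF prv_in_chord_ends])
    show "prv x \<le> w" using prv_le[of x] w(1) by simp
  next
    fix s assume s: "s \<in> chord_ends" "s \<le> w"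
    show "s \<le> prv x"
    proof (rule ccontr)
      assume "\<not> s \<le> prv x"
      then have "x < s" using prv_greatest[OF s(1), of x] by force
      then have "s \<in> ?W" using s w Min by auto
      then have "Min ?W \<le> s" using fin by (intro Min_le)
      then show False using s w by simp
    qed
  qed
  then show ?thesis using that Min by blast
qed

text \<open>Coherence speaks only of chords at \<open>a\<close> in \<open>A\<close>. A general chord
  end is, up to full turns, either \<open>a\<close> or \<open>a + N\<close>, according to the parity
  of \<open>s div N\<close>.\<close>

lemma coherent_chord:
  assumes "coherent_labelling N D A \<chi>" "s \<in> chord_ends"
  shows "\<chi> (s + k * N) = \<chi> s"
proof -
  have *: "\<chi> (s + N) = \<chi> s" if s: "s \<in> chord_ends" for s
  proof -
    let ?a = "s mod N"
    have a: "\<chi> (?a + N) = \<chi> ?a" using assms(1) s by (simp add: coherent_labelling_def chord_ends_def)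
    have s_eq: "s = ?a + (s div N) * N" by simp
    show ?thesis
    proof (cases "even (s div N)")
      case True
      then obtain j where "s div N = 2 * j" by (auto simp: dvd_def)
      then have "s = ?a + j * (2 * N)" "s + N = (?a + N) + j * (2 * N)" using s_eq by (simp_all add: algebra_simps)
      then show ?thesis using a coherent_labelling_period[OF assms(1)] by metis
    next
      case False
      then obtain j where "s div N = 2 * j + 1" by (auto elim: oddE)
      then have "s = (?a + N) + j * (2 * N)" "s + N = ?a + (j + 1) * (2 * N)"
        using s_eq by (simp_all add: algebra_simps)
      then show ?thesis using a coherent_labelling_period[OF assms(1)] by metis
    qed
  qed
  show ?thesis
  proof (induction k rule: int_induct[where k = 0])
    case (step1 i)
    have "\<chi> (s + i * N + N) = \<chi> (s + i * N)" using assms(2) chord_ends_shift by (intro *) blast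
    then show ?case using step1 by (simp add: algebra_simps)
  next
    case (step2 i)
    have "\<chi> (s + (i - 1) * N + N) = \<chi> (s + (i - 1) * N)" using assms(2) chord_ends_shift by (intro *) blast
    then show ?case using step2 by (simp add: algebra_simps)
  qed simp
qed

section \<open>Which sets of cuts leave the cycle with chords connected\<close>

lemma two_deletions_disconnect:
  assumes "u < v" "prv u = prv v" "u mod (2 * N) \<in> D" "v mod (2 * N) \<in> D"
  shows "\<not> ladder_connected N D A"
proof
  assume conn: "ladder_connected N D A"
  \<comment> \<open>The indicator of the cyclic interval from \<open>u + 1\<close> to
    \<open>v\<close>: a piece between two cuts on one arc, with no chord end in it and hence
    isolated.\<close>
  define \<chi> where "\<chi> z \<longleftrightarrow> (z - u - 1) mod (2 * N) < v - u" for z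
  have vu: "v - u < N" using prv_gt[of v] prv_le[of u] assms(2) by simp
  have "coherent_labelling N D A \<chi>"
    unfolding coherent_labelling_def
  proof (intro conjI allI ballI impI)
    fix z
    have "z + 2 * N - u - 1 = (z - u - 1) + 2 * N" by simp
    then show "\<chi> (z + 2 * N) = \<chi> z" unfolding \<chi>_def by (metis mod_add_self2)
  next
    fix z assume z: "z mod (2 * N) \<notin> D"
    let ?m = "(z - u - 1) mod (2 * N)"
    have dvd: "2 * N dvd (z - u - 1) - ?m" by simp
    have m: "0 \<le> ?m" "?m < 2 * N" using N_pos by simp_all
    \<comment> \<open>Along a rail the offset from \<open>u + 1\<close> grows by one, so the label
      can change only where the offset wraps around, at \<open>u\<close>, or passes
      \<open>v - u\<close>, at \<open>v\<close>; both rails are cut.\<close>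
    have m1: "?m \<noteq> 2 * N - 1"
    proof
      assume "?m = 2 * N - 1"
      then have "2 * N dvd (z - u - 1 - (2 * N - 1)) + 2 * N" using dvd by (metis dvd_add dvd_refl)
      then have "2 * N dvd z - u" by simp
      then show False using z assms(3) by (simp add: mod_eq_dvd_iff[symmetric])
    qed
    have m2: "?m \<noteq> v - u - 1"
    proof
      assume "?m = v - u - 1"
      then have "2 * N dvd z - v" using dvd by simp
      then show False using z assms(4) by (simp add: mod_eq_dvd_iff[symmetric])
    qed
    have "(z + 1 - u - 1) mod (2 * N) = (?m + 1) mod (2 * N)"
      by (simp add: mod_simps)
    also have "\<dots> = ?m + 1" using m m1 by simp
    finally show "\<chi> (z + 1) = \<chi> z" using m2 unfolding \<chi>_def by linarith
  next
    fix a assume a: "a \<in> A"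
    \<comment> \<open>A chord end in the interval would lie after \<open>u\<close> and yet be at
      most \<open>prv v\<close>, which equals \<open>prv u\<close>.\<close>
    have "\<not> \<chi> s" if s: "s \<in> chord_ends" for s
    proof
      assume "\<chi> s"
      define t where "t = u + 1 + (s - u - 1) mod (2 * N)"
      have "t = s + (- ((s - u - 1) div (2 * N)) * 2) * N"
        using minus_mult_div_eq_mod[of "s - u - 1" "2 * N", symmetric]
        by (simp add: t_def algebra_simps)
      then have "t \<in> chord_ends" using s by (simp only: chord_ends_shift)
      moreover have "u < t" "t \<le> v"
        using \<open>\<chi> s\<close> N_pos pos_mod_sign[of "2 * N" "s - u - 1"] unfolding \<chi>_def t_def by linarith+
      ultimately have "t \<le> prv v" by (intro prv_greatest)
      then show False using assms(2) prv_le[of u] \<open>u < t\<close> by simp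
    qed
    then show "\<chi> (a + N) = \<chi> a" using A_subset_chord_ends[OF a] chord_ends_shift[of a 1] by simp
  qed
  then have "\<chi> u = \<chi> (u + 1)" using conn by (auto simp: ladder_connected_def)
  moreover have "\<chi> (u + 1)" using assms(1) by (simp add: \<chi>_def)
  moreover have "(u - u - 1) mod (2 * N) = 2 * N - 1"
    using N_pos by (simp add: zmod_minus1)
  ultimately show False using vu N_pos by (simp add: \<chi>_def)
qed

lemma connected_imp_inj_on_arc:
  assumes "ladder_connected N D A" "D \<subseteq> {0..<2 * N}"
  shows "inj_on arc D"
proof (rule inj_onI, rule ccontr)
  fix x y assume xy: "x \<in> D" "y \<in> D" "arc x = arc y" "x \<noteq> y"
  obtain k where k: "prv (x + k * (2 * N)) = prv y" using arc_subst[OF xy(3)] by blast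
  let ?x = "x + k * (2 * N)"
  have m: "?x mod (2 * N) \<in> D" "y mod (2 * N) \<in> D" "?x mod (2 * N) = x" "y mod (2 * N) = y"
    using xy(1,2) assms(2) by auto
  then have "?x < y \<or> y < ?x" using xy(4) by (metis linorder_neqE)
  then show False
    using two_deletions_disconnect[of ?x y D] two_deletions_disconnect[of y ?x D] k m(1,2) assms(1) by auto
qed

text \<open>An uncut gap offers a detour around the rail at \<open>a\<close>: over the chord to
  \<open>a + N\<close>, along the opposite arc to \<open>t + N\<close>, over the next chord to
  \<open>t\<close>, and back to \<open>a + 1\<close>. One more cut there is harmless, so a connected
  \<open>D\<close> of maximal size must cut every gap.\<close>

lemma connected_insert_gap:
  assumes "ladder_connected N D A" "a \<in> A" "\<And>x. x \<in> D \<Longrightarrow> gap x \<noteq> a"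
  shows "ladder_connected N (insert a D) A"
  unfolding ladder_connected_def
proof (intro allI impI)
  fix \<chi> x y assume \<chi>: "coherent_labelling N (insert a D) A \<chi>"
  have aN: "0 \<le> a" "a < N" using assms(2) A_sub by auto
  have aS: "a \<in> chord_ends" by (rule A_subset_chord_ends[OF assms(2)])
  obtain t where t: "t \<in> chord_ends" "a < t" "t \<le> prv a + N" "\<And>w. a \<le> w \<Longrightarrow> w < t \<Longrightarrow> prv w = prv a"
    by (rule next_exists[of a]) blast
  note t = t[unfolded prv_chord_end[OF aS]]
  have notD: "w mod (2 * N) \<notin> D" if "gap w = a" for w
    using assms(3)[of "w mod (2 * N)"] that gap_mod by auto
  have gap_w: "gap w = a" if "a \<le> w" "w < t" for w
    using t(4)[OF that] aN by (simp add: gap_def)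
  have not_a: "w mod (2 * N) \<noteq> a" if "a < w" "w < a + 2 * N" for w
  proof
    assume "w mod (2 * N) = a"
    then have "w mod (2 * N) = a mod (2 * N)" using aN by simp
    then have "2 * N dvd w - a" by (simp add: mod_eq_dvd_iff)
    then show False using that zdvd_imp_le[of "2 * N" "w - a"] by simp
  qed
  \<comment> \<open>Both stretches of the detour stay strictly between \<open>a\<close> and
    \<open>a + 2 * N\<close>, so they avoid the new cut as well.\<close>
  have "\<chi> t = \<chi> (a + 1)"
  proof (rule coherent_labelling_segment[OF \<chi>])
    fix w assume "a + 1 \<le> w" "w < t"
    then show "w mod (2 * N) \<notin> insert a D"
      using notD[OF gap_w[of w]] not_a[of w] t(3) N_pos by auto
  qed (use t in simp)
  moreover have "\<chi> (t + N) = \<chi> (a + N)"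
  proof (rule coherent_labelling_segment[OF \<chi>])
    fix w assume w: "a + N \<le> w" "w < t + N"
    have "gap w = gap (w - N)" using gap_shift[of "w - N" 1] by simp
    also have "\<dots> = a" by (rule gap_w) (use w in auto)
    finally show "w mod (2 * N) \<notin> insert a D"
      using notD[of w] not_a[of w] w t(3) N_pos by auto
  qed (use t in simp)
  moreover have "\<chi> (t + N) = \<chi> t" "\<chi> (a + N) = \<chi> a"
    using coherent_chord[OF \<chi> t(1), of 1] coherent_chord[OF \<chi> aS, of 1] by simp_all
  ultimately have a1: "\<chi> (a + 1) = \<chi> a" by simp
  have "\<chi> (z + 1) = \<chi> z" if "z mod (2 * N) \<notin> D" for z
  proof (cases "z mod (2 * N) = a")
    case True
    have "\<chi> z = \<chi> a" using coherent_labelling_mod[OF \<chi>, of z] True by simp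
    moreover have "\<chi> (z + 1) = \<chi> (a + 1)"
    proof -
      have "(z + 1) mod (2 * N) = (a + 1) mod (2 * N)" using True by (metis mod_add_left_eq)
      then show ?thesis using coherent_labelling_mod[OF \<chi>] by metis
    qed
    ultimately show ?thesis using a1 by simp
  next
    case False
    then show ?thesis using \<chi> that by (simp add: coherent_labelling_def)
  qed
  then have "coherent_labelling N D A \<chi>" using \<chi> by (simp add: coherent_labelling_def)
  then show "\<chi> x = \<chi> y" using assms(1) by (auto simp: ladder_connected_def)
qed

text \<open>
  Exactly one gap, that of \<open>b\<close>, has both of its arcs cut. Starting behind it, a coherent labelling
  is carried from chord to chord through the uncut arcs until the start of gap \<open>b\<close> is reached again.
\<close>

lemma deletions_imp_connected:
  assumes "inj_on arc D" "gap ` D = A" "card D = card A + 1" "D \<subseteq> {0..<2 * N}"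
  shows "ladder_connected N D A"
  unfolding ladder_connected_def
proof (intro allI impI)
  fix \<chi> x y assume \<chi>: "coherent_labelling N D A \<chi>"
  have finD: "finite D" using assms(4) finite_subset by blast
  \<comment> \<open>Pigeonhole: two cuts share a gap. Without \<open>d\<close> the remaining
    \<open>card A\<close> cuts still meet all gaps, so \<open>gap\<close> is injective on them and
    only the gap of \<open>d\<close> is cut twice.\<close>
  have "\<not> inj_on gap D" using assms(2,3) card_image[of gap D] by auto
  then obtain d e where de: "d \<in> D" "e \<in> D" "d \<noteq> e" "gap d = gap e" by (auto simp: inj_on_def)
  have "gap ` D = insert (gap d) (gap ` (D - {d}))" using de(1) by auto
  moreover have "gap d \<in> gap ` (D - {d})" using de by auto
  ultimately have "gap ` (D - {d}) = A" using assms(2) by auto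
  moreover from this have "card (D - {d}) = card A" using de(1) assms(3) finD by simp
  ultimately have inj: "inj_on gap (D - {d})" by (intro eq_card_imp_inj_on) (use finD in auto)
  define b where "b = gap d"
  have bA: "b \<in> A" using gap_in_A by (simp add: b_def)
  have bS: "b \<in> chord_ends" by (rule A_subset_chord_ends[OF bA])
  have bN: "0 \<le> b" "b < N" using bA A_sub by auto
  \<comment> \<open>A change of label between consecutive chord ends forces a cut on their arc and,
    through the chords, on the opposite arc too. Outside gap \<open>b\<close> both cuts would remain
    in \<open>D - {d}\<close> and share a gap.\<close>
  have across: "\<chi> t = \<chi> s"
    if st: "s < t" "\<And>w. s \<le> w \<Longrightarrow> w < t \<Longrightarrow> prv w = s" "s \<in> chord_ends" "t \<in> chord_ends" "s mod N \<noteq> b" for s t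
  proof (rule ccontr)
    assume ne: "\<chi> t \<noteq> \<chi> s"
    have "\<exists>w. s \<le> w \<and> w < t \<and> w mod (2 * N) \<in> D"
      using coherent_labelling_segment[OF \<chi>, of s t] st(1) ne by (meson less_imp_le)
    then obtain w where w: "s \<le> w" "w < t" "w mod (2 * N) \<in> D" by blast
    have "\<chi> (t + N) \<noteq> \<chi> (s + N)"
      using ne coherent_chord[OF \<chi> st(3), of 1] coherent_chord[OF \<chi> st(4), of 1] by simp
    then have "\<exists>w. s + N \<le> w \<and> w < t + N \<and> w mod (2 * N) \<in> D"
      using coherent_labelling_segment[OF \<chi>, of "s + N" "t + N"] st(1) by (meson add_mono_thms_linordered_semiring(3) less_imp_le)
    then obtain w' where w': "s + N \<le> w'" "w' < t + N" "w' mod (2 * N) \<in> D" by blast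
    have p: "prv w = s" "prv (w' - N) = s" using st(2) w w' by simp_all
    have p': "prv w' = s + N" using prv_shift[of "w' - N" 1] p(2) by simp
    have g: "gap w = s mod N" "gap w' = s mod N" using p p' by (simp_all add: gap_def)
    have arcs: "arc (w mod (2 * N)) \<noteq> arc (w' mod (2 * N))"
      using arc_opposite_neq[of "w"] p p' prv_shift[of w 1] by (simp add: arc_mod) (simp add: arc_def)
    have "w mod (2 * N) \<noteq> d" "w' mod (2 * N) \<noteq> d"
      using g st(5) gap_mod[of w] gap_mod[of w'] by (auto simp: b_def)
    then have "w mod (2 * N) = w' mod (2 * N)"
      using inj w(3) w'(3) g by (auto simp: inj_on_def gap_mod)
    then show False using arcs by simp
  qed
  obtain c where c: "c \<in> chord_ends" "b < c" "c \<le> prv b + N" "\<And>w. b \<le> w \<Longrightarrow> w < c \<Longrightarrow> prv w = prv b"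
    by (rule next_exists[of b]) blast
  note c = c[unfolded prv_chord_end[OF bS]]
  have walk: "z \<le> b + N \<longrightarrow> \<chi> (prv z) = \<chi> c" if "c \<le> z" for z
    using that
  proof (induction z rule: int_ge_induct)
    case base
    show ?case using prv_chord_end[OF c(1)] by simp
  next
    case (step z)
    show ?case
    proof
      assume zb: "z + 1 \<le> b + N"
      then have IH: "\<chi> (prv z) = \<chi> c" using step.IH by simp
      show "\<chi> (prv (z + 1)) = \<chi> c"
      proof (cases "z + 1 \<in> chord_ends")
        case True
        have cz: "c \<le> prv z" by (rule prv_greatest[OF c(1) step.hyps])
        have "prv z mod N \<noteq> b"
        proof
          assume "prv z mod N = b"
          then have "prv z mod N = b mod N" using bN by simp
          then have "N dvd prv z - b" by (simp add: mod_eq_dvd_iff)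
          then show False using zdvd_imp_le[of N "prv z - b"] cz c(2) zb prv_le[of z] by simp
        qed
        moreover have "prv w = prv z" if "prv z \<le> w" "w < z + 1" for w
        proof (rule prv_eqI[OF prv_in_chord_ends that(1)])
          fix s assume "s \<in> chord_ends" "s \<le> w"
          then show "s \<le> prv z" using that(2) by (intro prv_greatest) auto
        qed
        moreover have "prv z < z + 1" using prv_le[of z] by simp
        ultimately have "\<chi> (z + 1) = \<chi> (prv z)"
          using across[OF _ _ prv_in_chord_ends True] by blast
        then show ?thesis using IH prv_chord_end[OF True] by simp
      next
        case False
        have "prv (z + 1) = prv z"
        proof (rule prv_eqI[OF prv_in_chord_ends])
          show "prv z \<le> z + 1" using prv_le[of z] by simp
        next
          fix s assume s: "s \<in> chord_ends" "s \<le> z + 1"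
          then have "s \<noteq> z + 1" using False by auto
          then show "s \<le> prv z" using s by (intro prv_greatest) auto
        qed
        then show ?thesis using IH by simp
      qed
    qed
  qed
  have on_ends: "\<chi> s = \<chi> c" if s: "s \<in> chord_ends" for s
  proof -
    \<comment> \<open>Labels of chord ends are \<open>N\<close>-periodic, so \<open>s\<close> may be
      moved into the window that starts at \<open>c\<close>. No chord end lies strictly between
      \<open>b + N\<close> and \<open>c + N\<close>, hence the walk, although it stops at
      \<open>b + N\<close>, meets them all.\<close>
    define s' where "s' = c + (s - c) mod N"
    have "s' = s + (- ((s - c) div N)) * N"
      using minus_mult_div_eq_mod[of "s - c" N, symmetric] by (simp add: s'_def algebra_simps)
    then have s': "s' \<in> chord_ends" "\<chi> s' = \<chi> s"
      using s by (simp_all only: chord_ends_shift coherent_chord[OF \<chi> s])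
    have cs: "c \<le> s'" "s' < c + N" using N_pos by (simp_all add: s'_def)
    have "s' \<le> b + N"
    proof (rule ccontr)
      assume "\<not> s' \<le> b + N"
      then have "b < s' - N" "s' - N < c" using cs by auto
      then have "prv (s' - N) = b" using c(4)[of "s' - N"] by simp
      moreover have "s' - N \<in> chord_ends" using s'(1) chord_ends_shift[of "s' - N" 1] by simp
      ultimately show False using prv_chord_end \<open>b < s' - N\<close> by simp
    qed
    then show ?thesis using walk[OF cs(1)] prv_chord_end[OF s'(1)] s'(2) by simp
  qed
  have "\<chi> z = \<chi> c" for z
  proof (rule ccontr)
    \<comment> \<open>If the label of \<open>z\<close> differs from that of the chord ends on both
      sides, there is a cut on each side of \<open>z\<close>, hence two cuts on one arc.\<close>
    assume ne: "\<chi> z \<noteq> \<chi> c"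
    obtain t where t: "t \<in> chord_ends" "z < t" "t \<le> prv z + N" "\<And>w. z \<le> w \<Longrightarrow> w < t \<Longrightarrow> prv w = prv z"
      by (rule next_exists[of z]) blast
    have "\<chi> z \<noteq> \<chi> (prv z)" "\<chi> t \<noteq> \<chi> z" using ne on_ends[OF prv_in_chord_ends] on_ends[OF t(1)] by auto
    then obtain w w' where w: "prv z \<le> w" "w < z" "w mod (2 * N) \<in> D"
      and w': "z \<le> w'" "w' < t" "w' mod (2 * N) \<in> D"
      using coherent_labelling_segment[OF \<chi> prv_le[of z]] coherent_labelling_segment[OF \<chi> less_imp_le[OF t(2)]]
      by blast
    have "prv w = prv z"
      by (rule prv_eqI[OF prv_in_chord_ends w(1)]) (use w(2) in \<open>auto intro: prv_greatest\<close>)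
    then have "arc (w mod (2 * N)) = arc (w' mod (2 * N))"
      using t(4)[OF w'(1,2)] unfolding arc_mod by (simp add: arc_def)
    then have "w mod (2 * N) = w' mod (2 * N)" using assms(1) w(3) w'(3) by (auto simp: inj_on_def)
    then have "2 * N dvd w' - w" by (metis mod_eq_dvd_iff)
    moreover have "0 < w' - w" "w' - w < N" using w w' t(3) by linarith+
    ultimately show False using zdvd_imp_le[of "2 * N" "w' - w"] by simp
  qed
  then show "\<chi> x = \<chi> y" by metis
qed

end

section \<open>Counting deletion sets\<close>

text \<open>Transversals are the images of choice functions on the fibres of \<open>g\<close>. The
  fibres are disjoint, so the image determines the function.\<close>

lemma card_transversals_prod:
  assumes "finite A"
  shows "card {T. T \<subseteq> U \<and> bij_betw g T A} = (\<Prod>a\<in>A. card {x \<in> U. g x = a})"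
proof -
  let ?F = "\<Pi>\<^sub>E a\<in>A. {x \<in> U. g x = a}"
  have "bij_betw (\<lambda>f. f ` A) ?F {T. T \<subseteq> U \<and> bij_betw g T A}"
  proof (rule bij_betwI')
    fix f h assume f: "f \<in> ?F" and h: "h \<in> ?F"
    have fP: "f a \<in> U" "g (f a) = a" if "a \<in> A" for a using f that by (auto simp: PiE_iff)
    have hP: "h a \<in> U" "g (h a) = a" if "a \<in> A" for a using h that by (auto simp: PiE_iff)
    have "f a = h a" if eq: "f ` A = h ` A" and a: "a \<in> A" for a
    proof -
      have "f a \<in> h ` A" using eq a by blast
      then obtain b where "b \<in> A" "f a = h b" by blast
      then show ?thesis using fP hP a by metis
    qed
    then show "(f ` A = h ` A) = (f = h)" using PiE_ext[OF f h] by blast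
  next
    fix f assume f: "f \<in> ?F"
    then have fP: "f a \<in> U" "g (f a) = a" if "a \<in> A" for a using that by (auto simp: PiE_iff)
    then have "bij_betw g (f ` A) A" by (intro bij_betw_byWitness[of _ f]) auto
    then show "f ` A \<in> {T. T \<subseteq> U \<and> bij_betw g T A}" using fP by auto
  next
    fix T assume "T \<in> {T. T \<subseteq> U \<and> bij_betw g T A}"
    then have T: "T \<subseteq> U" "inj_on g T" "g ` T = A" by (auto simp: bij_betw_def)
    let ?f = "restrict (the_inv_into T g) A"
    have f: "the_inv_into T g a \<in> T" "g (the_inv_into T g a) = a" if "a \<in> A" for a
      using that the_inv_into_into[OF T(2) _ subset_refl, of a] f_the_inv_into_f[OF T(2), of a]
      unfolding T(3) by simp_all
    have fF: "?f \<in> ?F"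
    proof (rule restrict_PiE_iff[THEN iffD2], intro ballI CollectI conjI)
      fix a assume "a \<in> A"
      then show "the_inv_into T g a \<in> U" "g (the_inv_into T g a) = a" using f T(1) by auto
    qed
    have "?f ` A = the_inv_into T g ` A" by (rule image_cong) auto
    then have "?f ` A = T" using the_inv_into_onto[OF T(2)] T(3) by simp
    then have "T = ?f ` A" ..
    then show "\<exists>f\<in>?F. T = f ` A" using fF by (rule bexI)
  qed
  then have "card ?F = card {T. T \<subseteq> U \<and> bij_betw g T A}" by (rule bij_betw_same_card)
  then show ?thesis using card_PiE[OF assms, of "\<lambda>a. {x \<in> U. g x = a}"] by simp
qed

text \<open>Both windows are complete residue systems modulo \<open>N\<close>; reduction into the
  other window is a bijection that preserves \<open>P\<close>.\<close>

lemma card_periodic_window: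
  fixes P :: "int \<Rightarrow> bool"
  assumes "0 < N" "\<And>x k. P (x + k * N) = P x"
  shows "card {x \<in> {a..<a + N}. P x} = card {x \<in> {b..<b + N}. P x}"
proof (rule bij_betw_same_card)
  have P: "P (c + (x - c) mod N) = P x" for c x
  proof -
    have "c + (x - c) mod N = x + (- ((x - c) div N)) * N"
      using minus_mult_div_eq_mod[of "x - c" N, symmetric] by (simp add: algebra_simps)
    then show ?thesis by (simp only: assms(2))
  qed
  have inv: "c + (d + (x - d) mod N - c) mod N = x" if "x \<in> {c..<c + N}" for c d x
  proof -
    have "d + (x - d) mod N - c = x - c + (- ((x - d) div N)) * N"
      using minus_mult_div_eq_mod[of "x - d" N, symmetric] by (simp add: algebra_simps)
    then have "(d + (x - d) mod N - c) mod N = (x - c) mod N" by (simp only: mod_mult_self1)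
    also have "\<dots> = x - c" using that by simp
    finally show ?thesis by simp
  qed
  have mem: "c + (x - c) mod N \<in> {c..<c + N}" for c x using assms(1) by simp
  show "bij_betw (\<lambda>x. b + (x - b) mod N) {x \<in> {a..<a + N}. P x} {x \<in> {b..<b + N}. P x}"
    by (rule bij_betw_byWitness[of _ "\<lambda>x. a + (x - a) mod N"]) (use P inv mem in auto)
qed

section \<open>Deletion sets and transversals\<close>

context chord_set
begin

text \<open>These turn out to be the cuts of the spanning trees whose chords are exactly
  \<open>A\<close>. At most one cut per arc, every gap cut, and one cut more than there are gaps:
  together this leaves exactly one gap cut on both arcs.\<close>

definition deletions :: "int set set" where
  "deletions = {D. D \<subseteq> {0..<2 * N} \<and> inj_on arc D \<and> gap ` D = A \<and> card D = card A + 1}"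

definition transversals :: "int set set" where
  "transversals = {T. T \<subseteq> {0..<2 * N} \<and> bij_betw gap T A}"

lemma finite_deletions: "finite deletions" and finite_transversals: "finite transversals"
  unfolding deletions_def transversals_def
  by (rule finite_subset[of _ "Pow {0..<2 * N}"], auto)+

lemma opposite_position:
  assumes "x \<in> {0..<2 * N}"
  defines "y \<equiv> (x + N) mod (2 * N)"
  shows "y \<in> {0..<2 * N}" "(y + N) mod (2 * N) = x" "arc y = arc (x + N)" "gap y = gap x"
proof -
  show "y \<in> {0..<2 * N}" using N_pos by (simp add: y_def)
  have "(y + N) mod (2 * N) = (x + 2 * N) mod (2 * N)" by (simp add: y_def mod_simps)
  then show "(y + N) mod (2 * N) = x" using assms(1) by simp
  show "arc y = arc (x + N)" by (simp add: y_def arc_mod)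
  show "gap y = gap x" using gap_shift[of x 1] by (simp add: y_def gap_mod)
qed

text \<open>Each gap holds exactly one element of \<open>T\<close>, hence exactly one of its two
  opposite arcs is occupied.\<close>

lemma arc_notin_transversal_iff:
  assumes "T \<in> transversals"
  shows "arc (x + N) \<in> arc ` T \<longleftrightarrow> arc x \<notin> arc ` T"
proof
  have T: "inj_on gap T" "gap ` T = A" using assms by (auto simp: transversals_def bij_betw_def)
  show "arc x \<notin> arc ` T" if "arc (x + N) \<in> arc ` T"
  proof
    assume "arc x \<in> arc ` T"
    with that obtain t u where tu: "t \<in> T" "u \<in> T" "arc x = arc t" "arc (x + N) = arc u" by auto
    then have "gap t = gap u" using gap_shift[of x 1] by (simp add: gap_arc)
    then have "t = u" using T(1) tu by (auto simp: inj_on_def)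
    then show False using tu arc_opposite_neq[of x] by simp
  qed
  show "arc (x + N) \<in> arc ` T" if "arc x \<notin> arc ` T"
  proof -
    have "gap x \<in> gap ` T" using T(2) gap_in_A by simp
    then obtain t where t: "t \<in> T" "gap t = gap x" by auto
    then show ?thesis using arc_cases[of t x] that by (metis image_eqI)
  qed
qed

text \<open>The antipodal map exchanges positions on occupied and on free arcs, so each kind makes
  up half of the \<open>2 * N\<close> positions.\<close>

lemma card_free_positions:
  assumes "T \<in> transversals"
  shows "card {x \<in> {0..<2 * N}. arc x \<notin> arc ` T} = nat N"
proof -
  let ?U = "{x \<in> {0..<2 * N}. arc x \<notin> arc ` T}" and ?V = "{x \<in> {0..<2 * N}. arc x \<in> arc ` T}"
  let ?\<sigma> = "\<lambda>x. (x + N) mod (2 * N)"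
  have "?\<sigma> x \<in> ?V" if "x \<in> ?U" for x
    using that opposite_position[of x] arc_notin_transversal_iff[OF assms, of x] by simp
  moreover have "?\<sigma> x \<in> ?U" if "x \<in> ?V" for x
    using that opposite_position[of x] arc_notin_transversal_iff[OF assms, of x] by simp
  moreover have "?\<sigma> (?\<sigma> x) = x" if "x \<in> {0..<2 * N}" for x
    using that by (rule opposite_position)
  ultimately have "bij_betw ?\<sigma> ?U ?V"
    by (intro bij_betw_byWitness[of _ ?\<sigma>]) blast+
  then have "card ?U = card ?V" by (rule bij_betw_same_card)
  moreover have "card (?U \<union> ?V) = card ?U + card ?V"
    by (rule card_Un_disjoint) (auto intro: finite_subset[of _ "{0..<2 * N}"])
  moreover have "?U \<union> ?V = {0..<2 * N}" by auto
  ultimately show ?thesis by simp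
qed

lemma transversal_extensions:
  assumes "T \<in> transversals"
  shows "{D \<in> deletions. T \<subseteq> D} = (\<lambda>x. insert x T) ` {x \<in> {0..<2 * N}. arc x \<notin> arc ` T}"
proof -
  have T: "T \<subseteq> {0..<2 * N}" "inj_on gap T" "gap ` T = A"
    using assms by (auto simp: transversals_def bij_betw_def)
  have finT: "finite T" using T(1) finite_subset by blast
  have cT: "card T = card A" using T card_image by metis
  have inj: "inj_on arc T" using T(2) by (auto simp: inj_on_def gap_arc)
  show ?thesis
  proof (intro equalityI subsetI)
    fix D assume "D \<in> {D \<in> deletions. T \<subseteq> D}"
    then have D: "D \<subseteq> {0..<2 * N}" "inj_on arc D" "card D = card A + 1" "T \<subseteq> D"
      by (auto simp: deletions_def)
    have "finite D" using D(1) finite_subset by blast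
    then have "card (D - T) = 1" using D cT finT by (simp add: card_Diff_subset)
    then obtain x where x: "D - T = {x}" by (auto simp: card_1_singleton_iff)
    then have "D = insert x T" "x \<notin> T" using D(4) by auto
    then show "D \<in> (\<lambda>x. insert x T) ` {x \<in> {0..<2 * N}. arc x \<notin> arc ` T}"
      using D(1,2) by auto
  next
    fix D assume "D \<in> (\<lambda>x. insert x T) ` {x \<in> {0..<2 * N}. arc x \<notin> arc ` T}"
    then obtain x where x: "D = insert x T" "x \<in> {0..<2 * N}" "arc x \<notin> arc ` T" by blast
    then have "x \<notin> T" by auto
    then show "D \<in> {D \<in> deletions. T \<subseteq> D}"
      using x T inj cT finT gap_in_A by (auto simp: deletions_def)
  qed
qed

lemma card_transversal_extensions:
  assumes "T \<in> transversals"
  shows "card {D \<in> deletions. T \<subseteq> D} = nat N"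
proof -
  have "inj_on (\<lambda>x. insert x T) {x \<in> {0..<2 * N}. arc x \<notin> arc ` T}"
    by (auto simp: inj_on_def)
  then show ?thesis
    unfolding transversal_extensions[OF assms] by (simp only: card_image card_free_positions[OF assms])
qed

lemma card_deletion_transversals:
  assumes "D \<in> deletions"
  shows "card {T \<in> transversals. T \<subseteq> D} = 2"
proof -
  have D: "D \<subseteq> {0..<2 * N}" "gap ` D = A" "card D = card A + 1"
    using assms by (auto simp: deletions_def)
  have finD: "finite D" using D(1) finite_subset by blast
  have "\<not> inj_on gap D" using D(2,3) card_image[of gap D] by auto
  then obtain d e where de: "d \<in> D" "e \<in> D" "d \<noteq> e" "gap d = gap e" by (auto simp: inj_on_def)
  have trans: "D - {x} \<in> transversals" if xy: "x \<in> D" "y \<in> D" "x \<noteq> y" "gap x = gap y" for x y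
  proof -
    have "gap ` D = insert (gap x) (gap ` (D - {x}))" using xy(1) by auto
    moreover have "gap x \<in> gap ` (D - {x})" using xy by auto
    ultimately have img: "gap ` (D - {x}) = A" using D(2) by auto
    have "card (D - {x}) = card A" using xy(1) D(3) finD by simp
    then have "inj_on gap (D - {x})" using img finD by (intro eq_card_imp_inj_on) auto
    then show ?thesis using img D(1) by (auto simp: transversals_def bij_betw_def)
  qed
  have "{T \<in> transversals. T \<subseteq> D} = {D - {d}, D - {e}}"
  proof (intro equalityI subsetI)
    fix T assume "T \<in> {T \<in> transversals. T \<subseteq> D}"
    then have T: "inj_on gap T" "gap ` T = A" "T \<subseteq> D"
      by (auto simp: transversals_def bij_betw_def)
    have finT: "finite T" using T(3) finD finite_subset by blast
    have "card T = card A" using T card_image by metis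
    then have "card (D - T) = 1" using D T finT by (simp add: card_Diff_subset)
    then obtain x where x: "D - T = {x}" by (auto simp: card_1_singleton_iff)
    \<comment> \<open>A transversal inside \<open>D\<close> misses one element only, and that must
      be \<open>d\<close> or \<open>e\<close>, since it cannot contain both.\<close>
    have "\<not> (d \<in> T \<and> e \<in> T)" using de T(1) by (auto simp: inj_on_def)
    then have "x = d \<or> x = e" using x de by auto
    moreover have "T = D - {x}" using x T(3) by auto
    ultimately show "T \<in> {D - {d}, D - {e}}" by auto
  next
    fix T assume "T \<in> {D - {d}, D - {e}}"
    then show "T \<in> {T \<in> transversals. T \<subseteq> D}" using trans[of d e] trans[of e d] de by auto
  qed
  moreover have "D - {d} \<noteq> D - {e}" using de by auto
  ultimately show ?thesis by simp
qed

text \<open>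
  Adding to a transversal any position on an arc that it misses gives a deletion set, and a
  deletion set contains two transversals, one for each choice in its doubly cut gap.
\<close>

lemma card_deletions: "2 * card deletions = nat N * card transversals"
proof -
  have "(\<Sum>T\<in>transversals. card {D \<in> deletions. T \<subseteq> D}) = 2 * card deletions"
    using card_deletion_transversals
    by (intro sum_multicount finite_deletions finite_transversals) auto
  then show ?thesis by (simp add: card_transversal_extensions mult.commute)
qed

text \<open>With \<open>t\<close> the next chord end after \<open>a\<close>, the window of length
  \<open>N\<close> from \<open>a\<close> meets the gap in \<open>{a..<t}\<close>; a full turn
  consists of two such windows, one for each arc.\<close>

lemma card_gap:
  assumes a: "a \<in> A" and t: "t \<in> chord_ends" "a < t" "t \<le> a + N" "\<And>s. s \<in> chord_ends \<Longrightarrow> s < t \<Longrightarrow> s \<le> a"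
  shows "card {x \<in> {0..<2 * N}. gap x = a} = nat (2 * (t - a))"
proof -
  have aN: "0 \<le> a" "a < N" using a A_sub by auto
  have aS: "a \<in> chord_ends" by (rule A_subset_chord_ends[OF a])
  have w: "{x \<in> {a..<a + N}. gap x = a} = {a..<t}"
  proof (intro equalityI subsetI)
    fix x assume x: "x \<in> {x \<in> {a..<a + N}. gap x = a}"
    have "x < t"
    proof (rule ccontr)
      assume "\<not> x < t"
      then have b: "t \<le> prv x" using t(1) by (intro prv_greatest) auto
      have "prv x mod N = a mod N" using x aN by (simp add: gap_def)
      then have "N dvd prv x - a" by (simp add: mod_eq_dvd_iff)
      then show False using zdvd_imp_le[of N "prv x - a"] b t(2) x prv_le[of x] by auto
    qed
    then show "x \<in> {a..<t}" using x by auto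
  next
    fix x assume x: "x \<in> {a..<t}"
    have "prv x = a" using x t(4) by (intro prv_eqI aS) auto
    then show "x \<in> {x \<in> {a..<a + N}. gap x = a}" using x t(3) aN by (auto simp: gap_def)
  qed
  have *: "card {x \<in> {b..<b + N}. gap x = a} = nat (t - a)" for b
    using card_periodic_window[of N "\<lambda>x. gap x = a" b a] N_pos gap_shift w by simp
  have fin: "finite {x \<in> {b..<c}. gap x = a}" for b c
    by (rule finite_subset[of _ "{b..<c}"]) auto
  have "{x \<in> {0..<2 * N}. gap x = a} = {x \<in> {0..<0 + N}. gap x = a} \<union> {x \<in> {N..<N + N}. gap x = a}"
    using N_pos by auto
  then have "card {x \<in> {0..<2 * N}. gap x = a} =
      card ({x \<in> {0..<0 + N}. gap x = a} \<union> {x \<in> {N..<N + N}. gap x = a})"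
    by (rule arg_cong)
  also have "\<dots> = card {x \<in> {0..<0 + N}. gap x = a} + card {x \<in> {N..<N + N}. gap x = a}"
    by (rule card_Un_disjoint[OF fin fin]) auto
  also have "\<dots> = nat (2 * (t - a))" unfolding * using t(2) by simp
  finally show ?thesis .
qed

end

text \<open>The gap that wraps around from \<open>Max A\<close> to \<open>Min A\<close> is left out, so that sets can be grown upwards.\<close>

definition step_product :: "int set \<Rightarrow> int" where
  "step_product A = (\<Prod>a\<in>A - {Max A}. 2 * (Min {b \<in> A. a < b} - a))"

lemma step_product_singleton: "step_product {m} = 1"
  by (simp add: step_product_def)

text \<open>A new largest element leaves every earlier successor unchanged, while the old maximum,
  so far left out, now contributes its distance to \<open>m\<close>.\<close>

lemma step_product_insert:
  assumes "finite A" "A \<noteq> {}" "Max A < m"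
  shows "step_product (insert m A) = step_product A * (2 * (m - Max A))"
proof -
  have lt: "a < m" if "a \<in> A" for a using assms that by (meson Max_ge le_less_trans)
  then have mA: "m \<notin> A" by auto
  have "Max (insert m A) = m" using assms(1) lt by (intro Max_eqI) (auto intro: less_imp_le)
  then have eq: "insert m A - {Max (insert m A)} = insert (Max A) (A - {Max A})"
    using mA Max_in[OF assms(1,2)] by auto
  have M: "Min {b \<in> insert m A. Max A < b} = m"
  proof -
    have "{b \<in> insert m A. Max A < b} = {m}"
      using assms Max_ge[OF assms(1)] by (force simp: not_less)
    then show ?thesis by simp
  qed
  have other: "Min {b \<in> insert m A. a < b} = Min {b \<in> A. a < b}" if a: "a \<in> A - {Max A}" for a
  proof -
    have "a < Max A" using a assms(1) by (simp add: less_le)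
    then have ne: "{b \<in> A. a < b} \<noteq> {}" using Max_in[OF assms(1,2)] by blast
    then obtain c where c: "c \<in> A" "a < c" by blast
    have fin: "finite {b \<in> A. a < b}" using assms(1) by simp
    have "{b \<in> insert m A. a < b} = insert m {b \<in> A. a < b}" using a lt by auto
    moreover have "Min {b \<in> A. a < b} \<le> c" using c fin by (intro Min_le) auto
    ultimately show ?thesis using Min_insert[OF fin ne, of m] lt[OF c(1)] by simp
  qed
  have "step_product (insert m A) =
      2 * (Min {b \<in> insert m A. Max A < b} - Max A) *
      (\<Prod>a\<in>A - {Max A}. 2 * (Min {b \<in> insert m A. a < b} - a))"
    unfolding step_product_def eq by (rule prod.insert) (use assms(1) in auto)
  also have "\<dots> = 2 * (m - Max A) * step_product A"
    unfolding step_product_def M by (intro arg_cong2[of _ _ _ _ "(*)"] prod.cong refl) (simp only: other)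
  finally show ?thesis by simp
qed

context chord_set
begin

text \<open>Each \<open>a\<close> in \<open>A\<close> starts a gap, which contributes twice the
  distance to the next chord end. After \<open>Max A\<close> that end is \<open>Min A + N\<close>,
  which gives the separate factor.\<close>

lemma card_transversals:
  "int (card transversals) = step_product A * (2 * (N - Max A + Min A))"
proof -
  have Max: "Max A \<in> A" and Min: "Min A \<in> A" using finite_A A_nonempty by auto
  have AN: "0 \<le> a" "a < N" if "a \<in> A" for a using that A_sub by auto
  have ends_A: "s \<in> A" if "s \<in> chord_ends" "0 \<le> s" "s < N" for s using that by (simp add: chord_ends_def)
  have last: "int (card {x \<in> {0..<2 * N}. gap x = Max A}) = 2 * (N - Max A + Min A)"
  proof -
    have "s \<le> Max A" if s: "s \<in> chord_ends" "s < Min A + N" for s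
    proof (rule ccontr)
      assume g: "\<not> s \<le> Max A"
      show False
      proof (cases "s < N")
        case True
        then have "s \<in> A" using ends_A s(1) g AN(1)[OF Max] by simp
        then show False using g finite_A by simp
      next
        case False
        have "s - N \<in> chord_ends" using s(1) chord_ends_shift[of "s - N" 1] by simp
        then have "s - N \<in> A" using ends_A False s(2) AN(2)[OF Min] by simp
        then show False using s(2) Min_le[OF finite_A] by force
      qed
    qed
    moreover have "Min A + N \<in> chord_ends" using A_subset_chord_ends[OF Min] chord_ends_shift[of "Min A" 1] by simp
    moreover have "Max A < Min A + N" using AN[OF Max] AN[OF Min] by simp
    moreover have "Min A + N \<le> Max A + N" using Max finite_A by simp
    ultimately have "card {x \<in> {0..<2 * N}. gap x = Max A} = nat (2 * (Min A + N - Max A))"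
      by (intro card_gap[OF Max])
    then show ?thesis using \<open>Max A < Min A + N\<close> by simp
  qed
  have other: "int (card {x \<in> {0..<2 * N}. gap x = a}) = 2 * (Min {b \<in> A. a < b} - a)"
    if a: "a \<in> A - {Max A}" for a
  proof -
    let ?t = "Min {b \<in> A. a < b}"
    have "a < Max A" using a finite_A by (simp add: less_le)
    then have "{b \<in> A. a < b} \<noteq> {}" using Max by blast
    then have t: "?t \<in> {b \<in> A. a < b}" using finite_A by (intro Min_in) auto
    have "s \<le> a" if s: "s \<in> chord_ends" "s < ?t" for s
    proof (rule ccontr)
      assume g: "\<not> s \<le> a"
      then have "s \<in> A" using ends_A[OF s(1)] s(2) t AN[of ?t] AN[of a] a by auto
      then have "?t \<le> s" using g finite_A by (intro Min_le) auto
      then show False using s(2) by simp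
    qed
    then have "card {x \<in> {0..<2 * N}. gap x = a} = nat (2 * (?t - a))"
      using a t AN[of ?t] AN[of a] A_subset_chord_ends[of ?t] by (intro card_gap) auto
    then show ?thesis using t by simp
  qed
  have "int (card transversals) = (\<Prod>a\<in>A. int (card {x \<in> {0..<2 * N}. gap x = a}))"
    unfolding transversals_def card_transversals_prod[OF finite_A] by simp
  also have "\<dots> = int (card {x \<in> {0..<2 * N}. gap x = Max A}) *
      (\<Prod>a\<in>A - {Max A}. int (card {x \<in> {0..<2 * N}. gap x = a}))"
    by (rule prod.remove[OF finite_A Max])
  also have "\<dots> = 2 * (N - Max A + Min A) * step_product A"
    unfolding last step_product_def by (simp only: prod.cong[OF refl other])
  finally show ?thesis by simp
qed

end

section \<open>Summation over chord sets\<close>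

lemma sum_nonempty_subsets_Suc:
  fixes f :: "nat set \<Rightarrow> 'a::comm_monoid_add"
  shows "(\<Sum>R\<in>Pow {..<Suc m} - {{}}. f R) =
    (\<Sum>R\<in>Pow {..<m} - {{}}. f R) + f {m} + (\<Sum>R\<in>Pow {..<m} - {{}}. f (insert m R))"
proof -
  let ?P = "Pow {..<m} - {{}}"
  \<comment> \<open>The sets that contain \<open>m\<close> come from all subsets of
    \<open>{..<m}\<close>. The empty one is later split off as \<open>f {m}\<close>, since
    \<open>Max\<close> and \<open>Min\<close> have no meaning for it.\<close>
  have "Pow {..<Suc m} - {{}} = ?P \<union> insert m ` Pow {..<m}"
    unfolding lessThan_Suc Pow_insert by auto
  then have "(\<Sum>R\<in>Pow {..<Suc m} - {{}}. f R) = sum f ?P + sum f (insert m ` Pow {..<m})"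
    by (simp only:) (rule sum.union_disjoint, auto)
  also have "sum f (insert m ` Pow {..<m}) = (\<Sum>R\<in>Pow {..<m}. f (insert m R))"
    by (rule sum.reindex[unfolded o_def]) (auto simp: inj_on_def)
  also have "\<dots> = f {m} + (\<Sum>R\<in>?P. f (insert m R))"
    by (rule sum.remove[of _ "{}", simplified]) auto
  finally show ?thesis by (simp add: ac_simps)
qed

text \<open>Chords sit at every third position, so consecutive indices k < k' in \<open>R\<close>
  contribute 6 (k' - k): two arcs of 3 (k' - k) rails each.\<close>

definition chord_weight :: "nat set \<Rightarrow> real" where
  "chord_weight R = of_int (step_product ((\<lambda>k. 3 * int k) ` R))"

lemma chord_weight_singleton: "chord_weight {m} = 1"
  by (simp add: chord_weight_def step_product_singleton)

lemma
  fixes R :: "nat set"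
  assumes "finite R" "R \<noteq> {}"
  shows Max_triple: "Max ((\<lambda>k. 3 * int k) ` R) = 3 * int (Max R)"
    and Min_triple: "Min ((\<lambda>k. 3 * int k) ` R) = 3 * int (Min R)"
  using mono_Max_commute[of "\<lambda>k. 3 * int k" R] mono_Min_commute[of "\<lambda>k. 3 * int k" R] assms
  by (auto simp: mono_def)

lemma nonempty_subset_bounds:
  fixes R :: "nat set"
  assumes "R \<in> Pow {..<m} - {{}}"
  shows "finite R" "R \<noteq> {}" "Max R < m"
proof -
  have "R \<subseteq> {..<m}" using assms by simp
  then show R1: "finite R" by (rule finite_subset) simp
  show R2: "R \<noteq> {}" using assms by simp
  show "Max R < m" using Max_in[OF R1 R2] assms by auto
qed

lemma chord_weight_insert:
  assumes "R \<in> Pow {..<m} - {{}}"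
  shows "chord_weight (insert m R) = chord_weight R * (6 * (real m - real (Max R)))"
proof -
  note R = nonempty_subset_bounds[OF assms]
  have "step_product (insert (3 * int m) ((\<lambda>k. 3 * int k) ` R)) =
      step_product ((\<lambda>k. 3 * int k) ` R) * (2 * (3 * int m - 3 * int (Max R)))"
    using R by (subst step_product_insert) (simp_all add: Max_triple)
  then show ?thesis by (simp add: chord_weight_def)
qed

lemma Max_Min_insert:
  fixes R :: "nat set"
  assumes "R \<in> Pow {..<m} - {{}}"
  shows "Max (insert m R) = m" "Min (insert m R) = Min R"
proof -
  note R = nonempty_subset_bounds[OF assms]
  have lt: "k < m" if "k \<in> R" for k using assms that by auto
  show "Max (insert m R) = m" using R lt by (intro Max_eqI) (auto intro: less_imp_le)
  show "Min (insert m R) = Min R"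
    using Min_insert[OF R(1,2), of m] lt[OF Min_in[OF R(1,2)]] by (simp del: Min_insert)
qed

text \<open>
  The four sums satisfy a linear recursion in \<open>m\<close> with matrix blocks of eigenvalues \<open>4 \<plusminus> sqrt 15\<close>.
\<close>

lemma chord_weight_sums:
  fixes m :: nat
  defines "s \<equiv> sqrt 15"
  defines "p \<equiv> (4 + s) ^ m" and "q \<equiv> (4 - s) ^ m" and "\<R> \<equiv> Pow {..<m} - {{}}"
  shows
    "(\<Sum>R\<in>\<R>. chord_weight R) = (p - q) / (2 * s)"
    "(\<Sum>R\<in>\<R>. chord_weight R * (real m - real (Max R))) = ((s + 3) * p + (s - 3) * q) / (12 * s) - 1 / 6"
    "(\<Sum>R\<in>\<R>. chord_weight R * real (Min R)) = ((s - 3) * p + (s + 3) * q) / (12 * s) - 1 / 6"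
    "(\<Sum>R\<in>\<R>. chord_weight R * real (Min R) * (real m - real (Max R))) = (p - q) / (12 * s) - m / 6"
  unfolding p_def q_def \<R>_def
proof (induction m)
  case 0
  have "s > 0" by (simp add: s_def)
  { case 1 show ?case by simp
  next case 2 show ?case using \<open>s > 0\<close> by (simp add: field_simps)
  next case 3 show ?case using \<open>s > 0\<close> by (simp add: field_simps)
  next case 4 show ?case by simp }
next
  case (Suc m)
  have s: "s > 0" "s * s = 15" by (simp_all add: s_def)
  \<comment> \<open>The final count needs \<open>?Q\<close> and \<open>?P'\<close>, the two halves
    of the wrapping factor; \<open>?P\<close> and \<open>?Q'\<close> make the recursion
    close.\<close>
  let ?P = "\<Sum>R\<in>Pow {..<m} - {{}}. chord_weight R"
  let ?Q = "\<Sum>R\<in>Pow {..<m} - {{}}. chord_weight R * (real m - real (Max R))"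
  let ?P' = "\<Sum>R\<in>Pow {..<m} - {{}}. chord_weight R * real (Min R)"
  let ?Q' = "\<Sum>R\<in>Pow {..<m} - {{}}. chord_weight R * real (Min R) * (real m - real (Max R))"
  have Q: "(\<Sum>R\<in>Pow {..<m} - {{}}. chord_weight R * (real (Suc m) - real (Max R))) = ?Q + ?P"
    by (simp add: sum.distrib[symmetric] algebra_simps)
  have Q': "(\<Sum>R\<in>Pow {..<m} - {{}}. chord_weight R * real (Min R) * (real (Suc m) - real (Max R))) = ?Q' + ?P'"
    by (simp add: sum.distrib[symmetric] algebra_simps)
  have N1: "(\<Sum>R\<in>Pow {..<m} - {{}}. chord_weight (insert m R)) = 6 * ?Q"
    by (simp add: sum_distrib_left chord_weight_insert mult.left_commute)
  have N2: "(\<Sum>R\<in>Pow {..<m} - {{}}. chord_weight (insert m R) * (real (Suc m) - real (Max (insert m R)))) = 6 * ?Q"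
    by (simp add: sum_distrib_left chord_weight_insert Max_Min_insert mult.left_commute)
  have N3: "(\<Sum>R\<in>Pow {..<m} - {{}}. chord_weight (insert m R) * real (Min (insert m R))) = 6 * ?Q'"
    by (simp add: sum_distrib_left chord_weight_insert Max_Min_insert mult_ac)
  have N4: "(\<Sum>R\<in>Pow {..<m} - {{}}. chord_weight (insert m R) * real (Min (insert m R)) * (real (Suc m) - real (Max (insert m R)))) = 6 * ?Q'"
    by (simp add: sum_distrib_left chord_weight_insert Max_Min_insert mult_ac)
  \<comment> \<open>The pair (\<open>?P\<close>, \<open>?Q\<close>) is mapped by the matrix with
    rows (1, 6) and (1, 7), plus (1, 1). Trace 8 and determinant 1 give x^2 - 8 x + 1, whence the
    root of 15; the fixed point (0, -1/6) explains the constant in the closed form.\<close>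
  have r1: "(\<Sum>R\<in>Pow {..<Suc m} - {{}}. chord_weight R) = ?P + 1 + 6 * ?Q"
    unfolding sum_nonempty_subsets_Suc N1 by (simp add: chord_weight_singleton)
  have r2: "(\<Sum>R\<in>Pow {..<Suc m} - {{}}. chord_weight R * (real (Suc m) - real (Max R))) = ?Q + ?P + 1 + 6 * ?Q"
    unfolding sum_nonempty_subsets_Suc N2 Q by (simp add: chord_weight_singleton)
  \<comment> \<open>The same matrix acts on (\<open>?P'\<close>, \<open>?Q'\<close>), now with
    \<open>m\<close> added because the set \<open>{m}\<close> has minimum \<open>m\<close>; a
    particular solution is (-1/6, -m/6).\<close>
  have r3: "(\<Sum>R\<in>Pow {..<Suc m} - {{}}. chord_weight R * real (Min R)) = ?P' + m + 6 * ?Q'"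
    unfolding sum_nonempty_subsets_Suc N3 by (simp add: chord_weight_singleton)
  have r4: "(\<Sum>R\<in>Pow {..<Suc m} - {{}}. chord_weight R * real (Min R) * (real (Suc m) - real (Max R))) = ?Q' + ?P' + m + 6 * ?Q'"
    unfolding sum_nonempty_subsets_Suc N4 Q' by (simp add: chord_weight_singleton)
  define x where "x = (4 + s) ^ m"
  define y where "y = (4 - s) ^ m"
  note IH = Suc.IH[folded x_def y_def]
  have pw: "(4 + s) ^ Suc m = (4 + s) * x" "(4 - s) ^ Suc m = (4 - s) * y"
    by (simp_all add: x_def y_def)
  have ss: "s * (s * c) = 15 * c" for c using s(2) by (simp add: mult.assoc[symmetric])
  { case 1 show ?case unfolding r1 IH pw using s by (simp add: field_simps ss)
  next case 2 show ?case unfolding r2 IH pw using s by (simp add: field_simps ss)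
  next case 3 show ?case unfolding r3 IH pw using s by (simp add: field_simps ss)
  next case 4 show ?case unfolding r4 IH pw using s by (simp add: field_simps ss) }
qed

section \<open>The octagonal network\<close>

text \<open>Counting from 0 along Plain 1, ..., Plain 3n, Bar 1, ..., Bar 3n turns the two crossed
  edges into ordinary rails and the rungs into antipodal chords at the multiples of 3.\<close>

definition position :: "nat \<Rightarrow> int \<Rightarrow> vertex" where
  "position n x = (let y = x mod (2 * (3 * int n)) in
     if y < 3 * int n then Plain (nat y + 1) else Bar (nat (y - 3 * int n) + 1))"

definition index_of :: "nat \<Rightarrow> vertex \<Rightarrow> int" where
  "index_of n v = (case v of Plain i \<Rightarrow> int i - 1 | Bar i \<Rightarrow> 3 * int n + int i - 1)"

definition rail :: "nat \<Rightarrow> int \<Rightarrow> vertex set" where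
  "rail n x = {position n x, position n (x + 1)}"

definition rung :: "nat \<Rightarrow> nat \<Rightarrow> vertex set" where
  "rung n k = {position n (3 * int k), position n (3 * int k + 3 * int n)}"

lemma position_plain: "0 \<le> x \<Longrightarrow> x < 3 * int n \<Longrightarrow> position n x = Plain (nat x + 1)"
  by (simp add: position_def)

lemma position_bar:
  "3 * int n \<le> x \<Longrightarrow> x < 6 * int n \<Longrightarrow> position n x = Bar (nat (x - 3 * int n) + 1)"
  by (simp add: position_def)

lemma position_cong: "x mod (2 * (3 * int n)) = y mod (2 * (3 * int n)) \<Longrightarrow> position n x = position n y"
  by (simp only: position_def)

lemma index_of_position:
  assumes "n \<ge> 1"
  shows "index_of n (position n x) = x mod (2 * (3 * int n))"
  using assms by (simp add: position_def index_of_def Let_def)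

lemma position_in_verts:
  assumes "n \<ge> 1"
  shows "position n x \<in> verts (mobius_octagonal n)"
proof -
  define y where "y = x mod (2 * (3 * int n))"
  have y: "0 \<le> y" "y < 2 * (3 * int n)" using assms by (simp_all add: y_def)
  then have "nat y + 1 \<in> {1..3 * n}" if "y < 3 * int n" using that by auto
  moreover have "nat (y - 3 * int n) + 1 \<in> {1..3 * n}" if "\<not> y < 3 * int n" using that y by auto
  ultimately show ?thesis
    unfolding position_def Let_def y_def[symmetric] mobius_octagonal_def by simp
qed

lemma verts_position:
  assumes "v \<in> verts (mobius_octagonal n)"
  shows "\<exists>x. v = position n x"
proof -
  from assms consider i where "v = Plain i" "1 \<le> i" "i \<le> 3 * n" | i where "v = Bar i" "1 \<le> i" "i \<le> 3 * n"
    by (auto simp: mobius_octagonal_def)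
  then show ?thesis
  proof cases
    case 1
    then have "v = position n (int i - 1)" by (subst position_plain) auto
    then show ?thesis ..
  next
    case 2
    then have "v = position n (3 * int n + (int i - 1))" by (subst position_bar) auto
    then show ?thesis ..
  qed
qed

lemma edges_mobius_octagonal:
  assumes "n \<ge> 1"
  shows "edges (mobius_octagonal n) = rail n ` {0..<2 * (3 * int n)} \<union> rung n ` {..<n}"
proof -
  let ?N = "3 * int n"
  have P: "{{Plain i, Plain (i + 1)} | i. 1 \<le> i \<and> i \<le> 3 * n - 1} = rail n ` {0..<?N - 1}"
  proof (intro equalityI subsetI)
    fix e assume "e \<in> {{Plain i, Plain (i + 1)} | i. 1 \<le> i \<and> i \<le> 3 * n - 1}"
    then obtain i where i: "e = {Plain i, Plain (i + 1)}" "1 \<le> i" "i \<le> 3 * n - 1" by auto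
    then have "e = rail n (int i - 1)" "int i - 1 \<in> {0..<?N - 1}"
      using assms by (auto simp: rail_def position_plain)
    then show "e \<in> rail n ` {0..<?N - 1}" by blast
  next
    fix e assume "e \<in> rail n ` {0..<?N - 1}"
    then obtain x where x: "e = rail n x" "0 \<le> x" "x < ?N - 1" by auto
    then have "e = {Plain (nat x + 1), Plain (nat x + 1 + 1)} \<and> 1 \<le> nat x + 1 \<and> nat x + 1 \<le> 3 * n - 1"
      by (auto simp: rail_def position_plain nat_add_distrib)
    then show "e \<in> {{Plain i, Plain (i + 1)} | i. 1 \<le> i \<and> i \<le> 3 * n - 1}" by blast
  qed
  have B: "{{Bar i, Bar (i + 1)} | i. 1 \<le> i \<and> i \<le> 3 * n - 1} = rail n ` {?N..<2 * ?N - 1}"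
  proof (intro equalityI subsetI)
    fix e assume "e \<in> {{Bar i, Bar (i + 1)} | i. 1 \<le> i \<and> i \<le> 3 * n - 1}"
    then obtain i where i: "e = {Bar i, Bar (i + 1)}" "1 \<le> i" "i \<le> 3 * n - 1" by auto
    then have "e = rail n (?N + (int i - 1))" "?N + (int i - 1) \<in> {?N..<2 * ?N - 1}"
      using assms by (auto simp: rail_def position_bar)
    then show "e \<in> rail n ` {?N..<2 * ?N - 1}" by blast
  next
    fix e assume "e \<in> rail n ` {?N..<2 * ?N - 1}"
    then obtain x where x: "e = rail n x" "?N \<le> x" "x < 2 * ?N - 1" by auto
    define i where "i = nat (x - ?N) + 1"
    have "nat (x + 1 - ?N) = i" using x by (simp add: i_def)
    then have "e = {Bar i, Bar (i + 1)} \<and> 1 \<le> i \<and> i \<le> 3 * n - 1"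
      using x by (auto simp: rail_def position_bar i_def)
    then show "e \<in> {{Bar i, Bar (i + 1)} | i. 1 \<le> i \<and> i \<le> 3 * n - 1}" by blast
  qed
  \<comment> \<open>The last rail wraps around to \<open>Plain 1\<close>; it and the rail at
    \<open>?N - 1\<close> are the two crossed edges.\<close>
  have "position n (2 * ?N) = position n 0" by (rule position_cong) simp
  then have C: "{{Plain (3 * n), Bar 1}, {Bar (3 * n), Plain 1}} = rail n ` {?N - 1, 2 * ?N - 1}"
    using assms by (simp add: rail_def position_plain position_bar nat_diff_distrib nat_mult_distrib)
  have D: "{{Plain i, Bar i} | i. 1 \<le> i \<and> i \<le> 3 * n \<and> i mod 3 = 1} = rung n ` {..<n}"
  proof (intro equalityI subsetI)
    fix e assume "e \<in> {{Plain i, Bar i} | i. 1 \<le> i \<and> i \<le> 3 * n \<and> i mod 3 = 1}"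
    then obtain i where i: "e = {Plain i, Bar i}" "i \<le> 3 * n" "i mod 3 = 1" by auto
    have k: "i = 3 * (i div 3) + 1" using i(3) mult_div_mod_eq[of 3 i] by linarith
    then have "i div 3 < n" using i(2) by linarith
    moreover from this have "rung n (i div 3) = {Plain (3 * (i div 3) + 1), Bar (3 * (i div 3) + 1)}"
      by (simp add: rung_def position_plain position_bar nat_mult_distrib)
    ultimately show "e \<in> rung n ` {..<n}" using i(1) k by (intro image_eqI[of _ _ "i div 3"]) simp_all
  next
    fix e assume "e \<in> rung n ` {..<n}"
    then obtain k where k: "e = rung n k" "k < n" by auto
    then have "e = {Plain (3 * k + 1), Bar (3 * k + 1)}"
      by (simp add: rung_def position_plain position_bar nat_mult_distrib)
    moreover have "1 \<le> 3 * k + 1" "3 * k + 1 \<le> 3 * n" "(3 * k + 1) mod 3 = 1" using k(2) by simp_all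
    ultimately show "e \<in> {{Plain i, Bar i} | i. 1 \<le> i \<and> i \<le> 3 * n \<and> i mod 3 = 1}" by blast
  qed
  have "{0..<2 * ?N} = {0..<?N - 1} \<union> {?N..<2 * ?N - 1} \<union> {?N - 1, 2 * ?N - 1}"
    using assms by auto
  then have "rail n ` {0..<2 * ?N} =
      rail n ` {0..<?N - 1} \<union> rail n ` {?N..<2 * ?N - 1} \<union> rail n ` {?N - 1, 2 * ?N - 1}"
    by (simp only: image_Un)
  then show ?thesis unfolding mobius_octagonal_def by (simp only: P B C D ugraph.simps)
qed

text \<open>By counting: 6n rail indices and n rung indices cover 7n edges, so no two indices give
  the same edge.\<close>

lemma edge_parametrization:
  assumes "n \<ge> 1"
  shows "inj_on (rail n) {0..<2 * (3 * int n)}" "inj_on (rung n) {..<n}"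
    "rail n ` {0..<2 * (3 * int n)} \<inter> rung n ` {..<n} = {}"
proof -
  let ?A = "rail n ` {0..<2 * (3 * int n)}" and ?B = "rung n ` {..<n}"
  have "card (?A \<union> ?B) = 7 * n"
    using card_edges_mobius_octagonal[OF assms] edges_mobius_octagonal[OF assms] by simp
  then have tot: "card ?A + card ?B = 7 * n + card (?A \<inter> ?B)"
    using card_Un_Int[of ?A ?B] by simp
  have le: "card ?A \<le> 6 * n" "card ?B \<le> n"
    using card_image_le[of "{0..<2 * (3 * int n)}" "rail n"] card_image_le[of "{..<n}" "rung n"] by simp_all
  have "card ?A = 6 * n" "card ?B = n" "card (?A \<inter> ?B) = 0" using tot le by linarith+
  then show "inj_on (rail n) {0..<2 * (3 * int n)}" "inj_on (rung n) {..<n}" "?A \<inter> ?B = {}"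
    by (auto intro!: eq_card_imp_inj_on)
qed

section \<open>Spanning trees as pairs of kept rungs and deleted rails\<close>

definition subladder :: "nat \<Rightarrow> int set \<Rightarrow> nat set \<Rightarrow> vertex set set" where
  "subladder n D R = rail n ` ({0..<2 * (3 * int n)} - D) \<union> rung n ` R"

text \<open>Rails are recorded by absence because the tree conditions speak of cuts. Both index sets
  can be read off an edge set, since the parametrization is injective and its two images are
  disjoint.\<close>

lemma bij_betw_subladder:
  assumes "n \<ge> 1"
  shows "bij_betw (\<lambda>(R, D). subladder n D R) (Pow {..<n} \<times> Pow {0..<2 * (3 * int n)})
    (Pow (edges (mobius_octagonal n)))"
proof -
  let ?I = "{0..<2 * (3 * int n)}"
  note inj = edge_parametrization[OF assms]
  have E: "edges (mobius_octagonal n) = rail n ` ?I \<union> rung n ` {..<n}"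
    by (rule edges_mobius_octagonal[OF assms])
  show ?thesis
  proof (rule bij_betw_byWitness[of _ "\<lambda>F. ({k \<in> {..<n}. rung n k \<in> F}, {x \<in> ?I. rail n x \<notin> F})"])
    show "\<forall>a\<in>Pow {..<n} \<times> Pow ?I. (\<lambda>F. ({k \<in> {..<n}. rung n k \<in> F}, {x \<in> ?I. rail n x \<notin> F}))
        ((\<lambda>(R, D). subladder n D R) a) = a"
    proof (clarify, intro conjI)
      fix R D assume R: "R \<subseteq> {..<n}" and D: "D \<subseteq> ?I"
      have "rung n k \<in> subladder n D R \<longleftrightarrow> k \<in> R" if "k \<in> {..<n}" for k
        using that R inj(2,3) unfolding subladder_def inj_on_def by blast
      then show "{k \<in> {..<n}. rung n k \<in> subladder n D R} = R" using R by blast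
      have "rail n x \<in> subladder n D R \<longleftrightarrow> x \<notin> D" if "x \<in> ?I" for x
        using that R inj(1,3) unfolding subladder_def inj_on_def by blast
      then show "{x \<in> ?I. rail n x \<notin> subladder n D R} = D" using D by blast
    qed
    show "\<forall>F\<in>Pow (edges (mobius_octagonal n)). (\<lambda>(R, D). subladder n D R)
        ({k \<in> {..<n}. rung n k \<in> F}, {x \<in> ?I. rail n x \<notin> F}) = F"
      unfolding E subladder_def by auto
    show "(\<lambda>(R, D). subladder n D R) ` (Pow {..<n} \<times> Pow ?I) \<subseteq> Pow (edges (mobius_octagonal n))"
      unfolding E subladder_def by auto
    show "(\<lambda>F. ({k \<in> {..<n}. rung n k \<in> F}, {x \<in> ?I. rail n x \<notin> F})) ` Pow (edges (mobius_octagonal n))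
        \<subseteq> Pow {..<n} \<times> Pow ?I"
      by auto
  qed
qed

lemma card_subladder:
  assumes "n \<ge> 1" "D \<subseteq> {0..<2 * (3 * int n)}" "R \<subseteq> {..<n}"
  shows "card (subladder n D R) + card D = 6 * n + card R"
proof -
  let ?I = "{0..<2 * (3 * int n)}"
  note inj = edge_parametrization[OF assms(1)]
  have fin: "finite D" "finite R" using assms(2,3) finite_subset by blast+
  have "card (subladder n D R) = card (rail n ` (?I - D)) + card (rung n ` R)"
    unfolding subladder_def using fin inj(3) assms(3) by (intro card_Un_disjoint) auto
  also have "card (rail n ` (?I - D)) = card (?I - D)"
    by (rule card_image, rule inj_on_subset[OF inj(1)]) auto
  also have "card (rung n ` R) = card R"
    by (rule card_image, rule inj_on_subset[OF inj(2) assms(3)])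
  also have "card (?I - D) = 6 * n - card D" using fin assms(2) by (simp add: card_Diff_subset)
  finally show ?thesis using card_mono[OF _ assms(2)] by simp
qed

lemma simple_graph_subladder:
  assumes "n \<ge> 1" "R \<subseteq> {..<n}"
  shows "simple_graph \<lparr>verts = verts (mobius_octagonal n), edges = subladder n D R\<rparr>"
proof (rule simple_graph_subset)
  show "simple_graph \<lparr>verts = verts (mobius_octagonal n), edges = edges (mobius_octagonal n)\<rparr>"
    using simple_graph_mobius_octagonal[OF assms(1)] by (simp add: simple_graph_def)
  show "subladder n D R \<subseteq> edges (mobius_octagonal n)"
    unfolding edges_mobius_octagonal[OF assms(1)] subladder_def using assms(2) by auto
qed

text \<open>Labellings of the vertices and coherent labellings of the integers translate into each
  other by composition with \<open>position\<close> and \<open>index_of\<close>.\<close>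

lemma connected_subladder_iff:
  assumes "n \<ge> 1" "R \<subseteq> {..<n}"
  shows "connected_graph \<lparr>verts = verts (mobius_octagonal n), edges = subladder n D R\<rparr> \<longleftrightarrow>
    ladder_connected (3 * int n) D ((\<lambda>k. 3 * int k) ` R)"
proof -
  let ?V = "verts (mobius_octagonal n)" and ?F = "subladder n D R"
  let ?N = "3 * int n" and ?A = "(\<lambda>k. 3 * int k) ` R"
  have V: "?V \<noteq> {}" using position_in_verts[OF assms(1)] by blast
  have "(\<forall>\<chi> :: vertex \<Rightarrow> bool. (\<forall>u v. {u, v} \<in> ?F \<longrightarrow> \<chi> u = \<chi> v) \<longrightarrow> (\<forall>u\<in>?V. \<forall>v\<in>?V. \<chi> u = \<chi> v))
      \<longleftrightarrow> ladder_connected ?N D ?A" (is "?L \<longleftrightarrow> ?R")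
  proof
    assume L: ?L
    show ?R
      unfolding ladder_connected_def
    proof (intro allI impI)
      fix \<psi> x y assume \<psi>: "coherent_labelling ?N D ?A \<psi>"
      let ?\<chi> = "\<lambda>v. \<psi> (index_of n v)"
      have \<chi>: "?\<chi> (position n z) = \<psi> z" for z
        using index_of_position[OF assms(1)] coherent_labelling_mod[OF \<psi>] by simp
      have "?\<chi> u = ?\<chi> v" if e: "{u, v} \<in> ?F" for u v
      proof -
        from e consider z where "z \<in> {0..<2 * ?N} - D" "{u, v} = rail n z" | k where "k \<in> R" "{u, v} = rung n k"
          by (auto simp: subladder_def)
        then show ?thesis
        proof cases
          case 1
          then have "z mod (2 * ?N) \<notin> D" by simp
          then have "\<psi> (z + 1) = \<psi> z" using \<psi> by (simp add: coherent_labelling_def)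
          then show ?thesis using 1(2) \<chi> by (auto simp: rail_def doubleton_eq_iff)
        next
          case 2
          then have "\<psi> (3 * int k + ?N) = \<psi> (3 * int k)" using \<psi> by (simp add: coherent_labelling_def)
          then show ?thesis using 2(2) \<chi> by (auto simp: rung_def doubleton_eq_iff)
        qed
      qed
      then have "\<forall>u\<in>?V. \<forall>v\<in>?V. ?\<chi> u = ?\<chi> v" by (intro L[THEN spec, THEN mp] allI impI)
      then have "?\<chi> (position n x) = ?\<chi> (position n y)" using position_in_verts[OF assms(1)] by blast
      then show "\<psi> x = \<psi> y" by (simp only: \<chi>)
    qed
  next
    assume R: ?R
    show ?L
    proof (intro allI impI ballI)
      fix \<chi> :: "vertex \<Rightarrow> bool" and u v
      assume \<chi>: "\<forall>u v. {u, v} \<in> ?F \<longrightarrow> \<chi> u = \<chi> v" and uv: "u \<in> ?V" "v \<in> ?V"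
      have "coherent_labelling ?N D ?A (\<lambda>x. \<chi> (position n x))"
        unfolding coherent_labelling_def
      proof (intro conjI allI impI ballI)
        fix x
        have "position n (x + 2 * ?N) = position n x" by (rule position_cong) simp
        then show "\<chi> (position n (x + 2 * ?N)) = \<chi> (position n x)" by simp
      next
        fix x assume x: "x mod (2 * ?N) \<notin> D"
        let ?y = "x mod (2 * ?N)"
        have "?y \<in> {0..<2 * ?N} - D" using x assms(1) by simp
        then have "{position n ?y, position n (?y + 1)} \<in> ?F" by (auto simp: subladder_def rail_def)
        then have "\<chi> (position n ?y) = \<chi> (position n (?y + 1))" using \<chi> by blast
        moreover have "position n ?y = position n x" by (rule position_cong) simp
        moreover have "position n (?y + 1) = position n (x + 1)" by (rule position_cong) (simp add: mod_simps)
        ultimately show "\<chi> (position n (x + 1)) = \<chi> (position n x)" by simp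
      next
        fix a assume "a \<in> ?A"
        then obtain k where k: "k \<in> R" "a = 3 * int k" by auto
        then have "{position n a, position n (a + ?N)} \<in> ?F" by (auto simp: subladder_def rung_def)
        then show "\<chi> (position n (a + ?N)) = \<chi> (position n a)" using \<chi> by blast
      qed
      then have "\<chi> (position n x) = \<chi> (position n y)" for x y
        using R unfolding ladder_connected_def by (elim allE impE)
      moreover obtain x y where "u = position n x" "v = position n y"
        using verts_position uv by metis
      ultimately show "\<chi> u = \<chi> v" by simp
    qed
  qed
  then show ?thesis
    using connected_graph_iff_labelling[OF V simple_graph_subladder[OF assms]] by simp
qed

text \<open>There are 6n vertices and 6n + card R - card D edges, so the edge count of a tree
  amounts to one cut more than rungs.\<close>

lemma tree_subladder_iff:
  assumes "n \<ge> 1" "D \<subseteq> {0..<2 * (3 * int n)}" "R \<subseteq> {..<n}"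
  shows "tree \<lparr>verts = verts (mobius_octagonal n), edges = subladder n D R\<rparr> \<longleftrightarrow>
    ladder_connected (3 * int n) D ((\<lambda>k. 3 * int k) ` R) \<and> card D = card R + 1"
  using tree_iff_card_edges[OF simple_graph_subladder[OF assms(1,3)], of D]
    connected_subladder_iff[OF assms(1,3), of D] card_subladder[OF assms] card_verts_mobius_octagonal[of n]
  by auto

text \<open>More cuts would leave too few edges to connect 6n vertices. This maximality, applied
  after \<open>connected_insert_gap\<close>, rules out uncut gaps.\<close>

lemma ladder_connected_card_le:
  assumes "n \<ge> 1" "D \<subseteq> {0..<2 * (3 * int n)}" "R \<subseteq> {..<n}"
    and "ladder_connected (3 * int n) D ((\<lambda>k. 3 * int k) ` R)"
  shows "card D \<le> card R + 1"
  using connected_graph_card_le[OF simple_graph_subladder[OF assms(1,3)], of D] assms(4)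
    connected_subladder_iff[OF assms(1,3), of D] card_subladder[OF assms(1-3)] card_verts_mobius_octagonal[of n]
  by auto

definition tree_deletions :: "nat \<Rightarrow> nat set \<Rightarrow> int set set" where
  "tree_deletions n R = {D. D \<subseteq> {0..<2 * (3 * int n)} \<and>
     ladder_connected (3 * int n) D ((\<lambda>k. 3 * int k) ` R) \<and> card D = card R + 1}"

lemma num_spanning_trees_eq_sum:
  assumes "n \<ge> 1"
  shows "num_spanning_trees (mobius_octagonal n) = (\<Sum>R\<in>Pow {..<n}. card (tree_deletions n R))"
proof -
  let ?G = "mobius_octagonal n" and ?I = "{0..<2 * (3 * int n)}"
  let ?T = "\<lambda>F. \<lparr>verts = verts ?G, edges = F\<rparr>"
  let ?\<F> = "{F \<in> Pow (edges ?G). tree (?T F)}"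
  have "{T. spanning_tree T ?G} = ?T ` ?\<F>"
  proof (intro equalityI subsetI)
    fix T assume T: "T \<in> {T. spanning_tree T ?G}"
    obtain V F where "T = \<lparr>verts = V, edges = F\<rparr>" by (cases T) auto
    with T show "T \<in> ?T ` ?\<F>" by (auto simp: spanning_tree_def)
  qed (auto simp: spanning_tree_def)
  moreover have "inj ?T" by (auto simp: inj_on_def)
  ultimately have 1: "num_spanning_trees ?G = card ?\<F>"
    unfolding num_spanning_trees_def by (metis (no_types, lifting) card_image inj_on_subset subset_UNIV)
  let ?S = "SIGMA R:Pow {..<n}. tree_deletions n R"
  have "bij_betw (\<lambda>(R, D). subladder n D R) ?S ?\<F>"
  proof (rule bij_betw_subset[OF bij_betw_subladder[OF assms]])
    show "?S \<subseteq> Pow {..<n} \<times> Pow ?I" by (auto simp: tree_deletions_def)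
    have *: "tree (?T (subladder n D R)) \<longleftrightarrow> D \<in> tree_deletions n R" if "R \<subseteq> {..<n}" "D \<subseteq> ?I" for R D
      using tree_subladder_iff[OF assms that(2,1)] that(2) by (simp add: tree_deletions_def)
    show "(\<lambda>(R, D). subladder n D R) ` ?S = ?\<F>"
    proof (intro equalityI subsetI)
      fix F assume "F \<in> (\<lambda>(R, D). subladder n D R) ` ?S"
      then obtain R D where RD: "F = subladder n D R" "R \<subseteq> {..<n}" "D \<in> tree_deletions n R" by auto
      then have D: "D \<subseteq> ?I" by (simp add: tree_deletions_def)
      then have "F \<in> Pow (edges ?G)"
        using bij_betw_imp_surj_on[OF bij_betw_subladder[OF assms]] RD by force
      then show "F \<in> ?\<F>" using * RD D by simp
    next
      fix F assume F: "F \<in> ?\<F>"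
      then have "F \<in> (\<lambda>(R, D). subladder n D R) ` (Pow {..<n} \<times> Pow ?I)"
        using bij_betw_imp_surj_on[OF bij_betw_subladder[OF assms]] by simp
      then obtain R D where RD: "F = subladder n D R" "R \<subseteq> {..<n}" "D \<subseteq> ?I" by auto
      then show "F \<in> (\<lambda>(R, D). subladder n D R) ` ?S" using F * by force
    qed
  qed
  then have "card ?\<F> = card ?S" by (rule bij_betw_same_card[symmetric])
  also have "\<dots> = (\<Sum>R\<in>Pow {..<n}. card (tree_deletions n R))"
    by (rule card_SigmaI) (auto simp: tree_deletions_def intro: finite_subset[of _ "Pow ?I"])
  finally show ?thesis using 1 by simp
qed

lemma card_tree_deletions_empty:
  assumes "n \<ge> 1"
  shows "card (tree_deletions n {}) = 6 * n"
proof -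
  let ?I = "{0..<2 * (3 * int n)}"
  have "tree_deletions n {} = (\<lambda>d. {d}) ` ?I"
    using ladder_connected_no_chords[of "3 * int n"] assms
    by (auto simp: tree_deletions_def card_1_singleton_iff)
  then show ?thesis by (simp add: card_image)
qed

lemma card_tree_deletions:
  assumes "n \<ge> 1" "R \<in> Pow {..<n} - {{}}"
  shows "real (card (tree_deletions n R)) =
    3 * real n / 2 * (chord_weight R * (6 * (real n - real (Max R) + real (Min R))))"
proof -
  let ?N = "3 * int n" and ?A = "(\<lambda>k. 3 * int k) ` R"
  have R: "finite R" "R \<noteq> {}" "R \<subseteq> {..<n}" using assms(2) nonempty_subset_bounds[of R n] by auto
  interpret chord_set ?N ?A
    by unfold_locales (use R assms(1) in auto)
  have cA: "card ?A = card R" by (simp add: card_image inj_on_def)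
  have le: "card D \<le> card ?A + 1" if "D \<subseteq> {0..<2 * ?N}" "ladder_connected ?N D ?A" for D
    using ladder_connected_card_le[OF assms(1) that(1) R(3) that(2)] cA by simp
  have "tree_deletions n R = deletions"
  proof (intro equalityI subsetI)
    fix D assume "D \<in> tree_deletions n R"
    then have D: "D \<subseteq> {0..<2 * ?N}" "ladder_connected ?N D ?A" "card D = card ?A + 1"
      by (simp_all add: tree_deletions_def cA)
    \<comment> \<open>If the gap of \<open>a\<close> were uncut, the rail at \<open>a\<close> could
      be cut too without losing connectivity, exceeding the maximal number of cuts.\<close>
    have "a \<in> gap ` D" if a: "a \<in> ?A" for a
    proof (rule ccontr)
      assume "a \<notin> gap ` D"
      then have no: "gap x \<noteq> a" if "x \<in> D" for x using that by auto
      have aS: "prv a = a" using prv_chord_end[OF A_subset_chord_ends[OF a]] .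
      have aN: "0 \<le> a" "a < ?N" using a A_sub by auto
      have "gap a = a" using aS aN by (simp add: gap_def)
      then have "a \<notin> D" using no by blast
      moreover have "card (insert a D) \<le> card ?A + 1"
        using connected_insert_gap[OF D(2) a no] D(1) aN by (intro le) auto
      moreover have "finite D" using D(1) finite_subset by blast
      ultimately show False using D(3) by simp
    qed
    then have "gap ` D = ?A" using gap_in_A by auto
    then show "D \<in> deletions"
      using D connected_imp_inj_on_arc[OF D(2,1)] by (simp add: deletions_def)
  next
    fix D assume "D \<in> deletions"
    then have D: "D \<subseteq> {0..<2 * ?N}" "inj_on arc D" "gap ` D = ?A" "card D = card ?A + 1"
      by (simp_all add: deletions_def)
    then show "D \<in> tree_deletions n R"
      using deletions_imp_connected[OF D(2,3,4,1)] cA by (simp add: tree_deletions_def)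
  qed
  then have "2 * card (tree_deletions n R) = nat ?N * card transversals"
    using card_deletions by simp
  then have "real (2 * card (tree_deletions n R)) = real (nat ?N * card transversals)"
    by (rule arg_cong)
  then have "2 * real (card (tree_deletions n R)) = 3 * real n * real (card transversals)" by simp
  moreover have "real (card transversals) = chord_weight R * (6 * (real n - real (Max R) + real (Min R)))"
  proof -
    have "real (card transversals) = of_int (int (card transversals))" by simp
    also have "\<dots> = of_int (step_product ?A * (2 * (?N - 3 * int (Max R) + 3 * int (Min R))))"
      unfolding card_transversals Max_triple[OF R(1,2)] Min_triple[OF R(1,2)] ..
    finally show ?thesis by (simp add: chord_weight_def)
  qed
  ultimately show ?thesis by simp
qed

theorem theorem3p5:
  fixes n :: nat
  assumes "n \<ge> 2"
  shows "real (num_spanning_trees (mobius_octagonal n)) =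
    3 * real n / 2 * ((4 + sqrt 15) ^ n + (4 - sqrt 15) ^ n + 2)"
proof -
  let ?s = "sqrt 15" and ?\<R> = "Pow {..<n} - {{}}"
  have n: "n \<ge> 1" using assms by simp
  define p where "p = (4 + ?s) ^ n"
  define q where "q = (4 - ?s) ^ n"
  have "(\<Sum>R\<in>?\<R>. chord_weight R * (6 * (real n - real (Max R) + real (Min R)))) =
      6 * ((\<Sum>R\<in>?\<R>. chord_weight R * (real n - real (Max R))) + (\<Sum>R\<in>?\<R>. chord_weight R * real (Min R)))"
    by (simp add: sum_distrib_left sum.distrib[symmetric] algebra_simps)
  also have "\<dots> = p + q - 2"
  proof -
    \<comment> \<open>An identity for every positive \<open>s\<close>: the terms with 3 cancel
      between the two closed forms, and the two constants -1/6 give the -2.\<close>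
    have "6 * (((s + 3) * p + (s - 3) * q) / (12 * s) - 1 / 6 +
        (((s - 3) * p + (s + 3) * q) / (12 * s) - 1 / 6)) = p + q - 2" if "0 < s" for s :: real
      using that by (simp add: field_simps)
    from this[of ?s] show ?thesis unfolding chord_weight_sums p_def q_def by simp
  qed
  finally have sum: "(\<Sum>R\<in>?\<R>. chord_weight R * (6 * (real n - real (Max R) + real (Min R)))) = p + q - 2" .
  have "real (num_spanning_trees (mobius_octagonal n)) = (\<Sum>R\<in>Pow {..<n}. real (card (tree_deletions n R)))"
    by (simp add: num_spanning_trees_eq_sum[OF n])
  also have "\<dots> = real (card (tree_deletions n {})) + (\<Sum>R\<in>?\<R>. real (card (tree_deletions n R)))"
    by (rule sum.remove) auto
  also have "(\<Sum>R\<in>?\<R>. real (card (tree_deletions n R))) = 3 * real n / 2 * (p + q - 2)"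
    by (simp only: card_tree_deletions[OF n] sum_distrib_left[symmetric] sum cong: sum.cong)
  finally show ?thesis
    unfolding card_tree_deletions_empty[OF n] p_def[symmetric] q_def[symmetric] by (simp add: field_simps)
qed

end
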